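(* Let $q\ge2$ and $n\ge1$. The $W_t(j)$ coefficients for the quantum metric on the $n$th symmetric power of the defining representation of $\mathfrak{su}(q)$ are given by $$W_t(j)=\frac{(2t+q-1)(n-j)!(n+j+q-1)!}{(n-t)!(n+t+q-1)!}\sum_{s=\max(0,t+j-n)}^{t}(-1)^s\frac{(2t+q-2-s)!\,(s+n-t)!^2}{s!\,(s-(t+j-n))!\,(s+n-t+j+q-1)!\,(t-s)!^2}$$ for $0\le t,j\le n$.
   Context: The $\mathfrak{su}(q)$ symmetric power quantum metric: $\mathcal{H}=\operatorname{Sym}^n(\mathbb{C}^q)\subseteq(\mathbb{C}^q)^{\otimes n}$ is the $n$th symmetric power of the defining representation of $\mathfrak{su}(q)$ with the inherited inner product, $\phi:\mathfrak{su}(q)\to\mathcal{L}(\mathcal{H})$ is the action, $\mathcal{E}=\operatorname{span}_{\mathbb{C}}(I_{\mathcal{H}},\phi(\mathfrak{su}(q)))$, $\mathcal{E}_t=\mathbb{C}I_{\mathcal{H}}$ for $0\le t<1$ and $\mathcal{E}_t=\mathcal{E}^{\lfloor t\rfloor}$ (span of products of $\lfloor t\rfloor$ elements of $\mathcal{E}$) for $t\ge1$. Its diameter (smallest $r$ with $\mathcal{E}_r=\mathcal{L}(\mathcal{H})$) is $r=n$. On $\mathcal{L}(\mathcal{H})$ use the Hilbert–Schmidt inner product $\operatorname{tr}(E^*F)$; put $\mathcal{V}_0=\mathbb{C}I_{\mathcal{H}}$ and $\mathcal{V}_t=\mathcal{E}_t\cap\mathcal{E}_{t-1}^\perp$ for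 $1\le t\le n$. $W_t(j)$ coefficients: for $\mathcal{B}_t$ any orthonormal basis of $\mathcal{V}_t$, let $\Phi_t(X)=\sum_{E\in\mathcal{B}_t}EXE^*$ and let $\Pi_t(X)=\sum_{E\in\mathcal{B}_t}\operatorname{tr}(E^*X)E$ (the orthogonal projection onto $\mathcal{V}_t$), as linear maps on the self-adjoint operators. The coefficients $W_t(j)\in\mathbb{R}$ are the unique numbers with $\Phi_t=\sum_{j=0}^{r}W_t(j)\Pi_j$ for $0\le t\le r$; equivalently $\Phi_t(X)=W_t(j)X$ for $X\in\mathcal{V}_j$ (such numbers exist for this metric). *)

theory Defs
  imports "HOL-Analysis.Analysis"
begin

(* The tensor power of n copies of C^q has the standard basis indexed by functions 'n => 'q
   (slot k carries the basis vector f k), where CARD('n) = n and CARD('q) = q. *)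

type_synonym ('n, 'q) tensor = "complex ^ ('n \<Rightarrow> 'q)"
type_synonym ('n, 'q) tensor_op = "complex ^ ('n \<Rightarrow> 'q) ^ ('n \<Rightarrow> 'q)"

definition cinner :: "complex ^ 'm \<Rightarrow> complex ^ 'm \<Rightarrow> complex" where
  "cinner \<phi> \<psi> = (\<Sum>i\<in>UNIV. cnj (\<phi> $ i) * \<psi> $ i)"

definition adj :: "complex ^ 'm ^ 'm \<Rightarrow> complex ^ 'm ^ 'm" where
  "adj A = map_matrix cnj (transpose A)"

definition hs_inner :: "complex ^ 'm ^ 'm \<Rightarrow> complex ^ 'm ^ 'm \<Rightarrow> complex" where
  "hs_inner A B = trace (adj A ** B)"

definition cscale :: "complex \<Rightarrow> complex ^ 'm ^ 'm \<Rightarrow> complex ^ 'm ^ 'm" where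
  "cscale c A = map_matrix ((*) c) A"

(* Provides cmat.span, the complex linear span; the unqualified span is the real one. *)
interpretation cmat: vector_space "cscale :: complex \<Rightarrow> complex ^ 'm ^ 'm \<Rightarrow> _"
  by unfold_locales (simp_all add: cscale_def vec_eq_iff algebra_simps)

definition Sym :: "('n::finite, 'q::finite) tensor set" where
  "Sym = {\<psi>. \<forall>\<pi>. bij \<pi> \<longrightarrow> (\<forall>f. \<psi> $ (f \<circ> \<pi>) = \<psi> $ f)}"

(* An operator on Sym is represented by its extension by 0 on the orthogonal complement of Sym
   in the tensor power.  This is an injective *-homomorphism and preserves traces, so products,
   adjoints, traces and the Hilbert-Schmidt inner product of operators on Sym are those of the
   representing matrices. *)

definition L_Sym :: "('n::finite, 'q::finite) tensor_op set" where
  "L_Sym = {T. (\<forall>\<psi>. T *v \<psi> \<in> Sym) \<and> (\<forall>\<psi>. (\<forall>\<xi>\<in>Sym. cinner \<xi> \<psi> = 0) \<longrightarrow> T *v \<psi> = 0)}"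

(* The identity operator of Sym, i.e. the orthogonal projection onto Sym
   (see id_Sym_in_L_Sym and id_Sym_acts), as the average of the slot permutations. *)

definition id_Sym :: "('n::finite, 'q::finite) tensor_op" where
  "id_Sym = (\<chi> f g. of_nat (card {\<pi>. bij \<pi> \<and> f \<circ> \<pi> = g}) / fact CARD('n))"

definition su :: "(complex ^ 'q ^ 'q) set" where
  "su = {A. adj A = - A \<and> trace A = 0}"

(* Sum over the slots k of A acting in slot k and the identity acting in the other slots. *)

definition tensor_act :: "complex ^ 'q ^ 'q \<Rightarrow> ('n::finite, 'q::finite) tensor_op" where
  "tensor_act A = (\<chi> f g. \<Sum>k\<in>UNIV. A $ f k $ g k * (\<Prod>l\<in>UNIV - {k}. mat 1 $ f l $ g l))"

definition sym_act :: "complex ^ 'q ^ 'q \<Rightarrow> ('n::finite, 'q::finite) tensor_op" where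
  "sym_act A = tensor_act A ** id_Sym"

definition E_gen :: "('n::finite, 'q::finite) tensor_op set" where
  "E_gen = cmat.span (insert id_Sym (sym_act ` su))"

primrec E_products :: "nat \<Rightarrow> ('n::finite, 'q::finite) tensor_op set" where
  "E_products 0 = {id_Sym}"
| "E_products (Suc k) = {A ** B | A B. A \<in> E_gen \<and> B \<in> E_products k}"

definition E_filt :: "real \<Rightarrow> ('n::finite, 'q::finite) tensor_op set" where
  "E_filt t = (if t < 1 then cmat.span {id_Sym} else cmat.span (E_products (nat \<lfloor>t\<rfloor>)))"

definition V_space :: "nat \<Rightarrow> ('n::finite, 'q::finite) tensor_op set" where
  "V_space t = (if t = 0 then cmat.span {id_Sym}
     else {X \<in> E_filt (real t). \<forall>Y \<in> E_filt (real t - 1). hs_inner Y X = 0})"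

definition is_onb :: "(complex ^ 'm ^ 'm) set \<Rightarrow> (complex ^ 'm ^ 'm) set \<Rightarrow> bool" where
  "is_onb B V \<longleftrightarrow> finite B \<and> cmat.span B = V \<and>
     (\<forall>E\<in>B. \<forall>F\<in>B. hs_inner E F = (if E = F then 1 else 0))"

definition Phi_map :: "(complex ^ 'm ^ 'm) set \<Rightarrow> complex ^ 'm ^ 'm \<Rightarrow> complex ^ 'm ^ 'm" where
  "Phi_map B X = (\<Sum>E\<in>B. E ** X ** adj E)"

definition Pi_map :: "(complex ^ 'm ^ 'm) set \<Rightarrow> complex ^ 'm ^ 'm \<Rightarrow> complex ^ 'm ^ 'm" where
  "Pi_map B X = (\<Sum>E\<in>B. cscale (hs_inner E X) E)"

(* The diameter of the metric is CARD('n).  Only the values W t j with t, j \<le> CARD('n) matter. *)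

definition W_coeffs :: "'n::finite itself \<Rightarrow> 'q::finite itself \<Rightarrow> (nat \<Rightarrow> nat \<Rightarrow> real) \<Rightarrow> bool" where
  "W_coeffs _ _ W \<longleftrightarrow>
     (\<forall>B :: nat \<Rightarrow> ('n, 'q) tensor_op set. (\<forall>t \<le> CARD('n). is_onb (B t) (V_space t)) \<longrightarrow>
        (\<forall>t \<le> CARD('n). \<forall>X \<in> L_Sym. adj X = X \<longrightarrow>
           Phi_map (B t) X = (\<Sum>j \<le> CARD('n). W t j *\<^sub>R Pi_map (B j) X)))"

lemma sum_bij_comp:
  fixes h :: "('n::finite \<Rightarrow> 'q::finite) \<Rightarrow> 'c::comm_monoid_add" and \<pi> :: "'n \<Rightarrow> 'n"
  assumes "bij \<pi>"
  shows "(\<Sum>f\<in>UNIV. h (f \<circ> \<pi>)) = (\<Sum>f\<in>UNIV. h f)"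
proof -
  have "bij (\<lambda>f :: 'n \<Rightarrow> 'q. f \<circ> \<pi>)"
    using assms
    by (intro o_bij[where g = "\<lambda>f. f \<circ> inv \<pi>"])
       (auto simp: fun_eq_iff bij_is_inj bij_is_surj surj_f_inv_f)
  then show ?thesis
    by (rule sum.reindex_bij_betw)
qed

lemma card_bij: "card {\<pi> :: 'n::finite \<Rightarrow> 'n. bij \<pi>} = fact CARD('n)"
  using card_permutations[of "UNIV :: 'n set" "CARD('n)"]
  by (simp add: bij_iff permutes_def)

lemma id_Sym_mult:
  "(id_Sym *v \<psi>) $ f = (\<Sum>\<pi> | bij \<pi>. \<psi> $ (f \<circ> \<pi>)) / fact CARD('n)"
  for \<psi> :: "('n::finite, 'q::finite) tensor"
proof -
  let ?S = "{\<pi> :: 'n \<Rightarrow> 'n. bij \<pi>}"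
  have "(\<Sum>\<pi>\<in>?S. \<psi> $ (f \<circ> \<pi>)) = (\<Sum>\<pi>\<in>?S. \<Sum>g\<in>UNIV. if f \<circ> \<pi> = g then \<psi> $ g else 0)"
    by simp
  also have "\<dots> = (\<Sum>g\<in>UNIV. \<Sum>\<pi>\<in>?S. if f \<circ> \<pi> = g then \<psi> $ g else 0)"
    by (rule sum.swap)
  also have "\<dots> = (\<Sum>g\<in>UNIV. of_nat (card {\<pi>. bij \<pi> \<and> f \<circ> \<pi> = g}) * \<psi> $ g)"
    by (intro sum.cong refl) (simp add: sum.If_cases Int_def)
  finally show ?thesis
    by (simp add: id_Sym_def matrix_vector_mult_def sum_divide_distrib)
qed

lemma id_Sym_acts: "\<psi> \<in> Sym \<Longrightarrow> id_Sym *v \<psi> = \<psi>"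
  by (simp add: vec_eq_iff id_Sym_mult Sym_def card_bij)

lemma id_Sym_range: "id_Sym *v \<psi> \<in> Sym"
  for \<psi> :: "('n::finite, 'q::finite) tensor"
proof -
  have "(\<Sum>\<pi> | bij \<pi>. \<psi> $ (f \<circ> \<sigma> \<circ> \<pi>)) = (\<Sum>\<pi> | bij \<pi>. \<psi> $ (f \<circ> \<pi>))" if "bij \<sigma>"
    for f :: "'n \<Rightarrow> 'q" and \<sigma> :: "'n \<Rightarrow> 'n"
    by (rule sum.reindex_bij_witness[where i = "\<lambda>\<pi>. inv \<sigma> \<circ> \<pi>" and j = "\<lambda>\<pi>. \<sigma> \<circ> \<pi>"])
       (use that in \<open>auto simp: fun_eq_iff bij_is_inj bij_is_surj surj_f_inv_f bij_comp
          bij_imp_bij_inv o_assoc\<close>)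
  then show ?thesis
    by (simp add: Sym_def id_Sym_mult)
qed

lemma id_Sym_self_adjoint:
  "cinner (id_Sym *v \<phi>) \<psi> = cinner \<phi> (id_Sym *v \<psi>)"
  for \<phi> \<psi> :: "('n::finite, 'q::finite) tensor"
proof -
  let ?c = "\<lambda>f g :: 'n \<Rightarrow> 'q. card {\<pi> :: 'n \<Rightarrow> 'n. bij \<pi> \<and> f \<circ> \<pi> = g}"
  have inv: "g \<circ> inv \<pi> = f" if "bij \<pi>" "f \<circ> \<pi> = g" for f g :: "'n \<Rightarrow> 'q" and \<pi> :: "'n \<Rightarrow> 'n"
    using that by (metis comp_assoc comp_id bij_is_surj surj_iff)
  have c: "?c f g = ?c g f" for f g
    by (rule bij_betw_same_card[of inv], rule bij_betw_byWitness[where f' = inv])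
       (auto simp: inv_inv_eq bij_imp_bij_inv inv)
  have "cinner (id_Sym *v \<phi>) \<psi>
      = (\<Sum>f\<in>UNIV. \<Sum>g\<in>UNIV. of_nat (?c f g) / fact CARD('n) * cnj (\<phi> $ g) * \<psi> $ f)"
    by (simp add: cinner_def id_Sym_def matrix_vector_mult_def sum_distrib_right)
  also have "\<dots> = (\<Sum>g\<in>UNIV. \<Sum>f\<in>UNIV. of_nat (?c f g) / fact CARD('n) * cnj (\<phi> $ g) * \<psi> $ f)"
    by (rule sum.swap)
  also have "\<dots> = cinner \<phi> (id_Sym *v \<psi>)"
    unfolding cinner_def id_Sym_def matrix_vector_mult_def
    by (simp add: sum_distrib_left c mult_ac)
  finally show ?thesis .
qed

lemma id_Sym_in_L_Sym: "id_Sym \<in> L_Sym"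
proof -
  have "id_Sym *v \<psi> = 0" if "\<forall>\<xi>\<in>Sym. cinner \<xi> \<psi> = 0" for \<psi> :: "('n::finite, 'q::finite) tensor"
  proof -
    let ?p = "id_Sym *v \<psi>"
    have "cinner ?p ?p = cinner (id_Sym *v ?p) \<psi>"
      by (simp add: id_Sym_self_adjoint)
    then have "cinner ?p ?p = 0"
      using that id_Sym_range by metis
    moreover have "cinner ?p ?p = of_real (\<Sum>f\<in>UNIV. (cmod (?p $ f))\<^sup>2)"
      by (simp add: cinner_def complex_norm_square mult.commute flip: of_real_power)
    ultimately have "(\<Sum>f\<in>UNIV. (cmod (?p $ f))\<^sup>2) = 0"
      by (metis of_real_eq_0_iff)
    then show ?thesis
      by (simp add: sum_nonneg_eq_0_iff vec_eq_iff)
  qed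
  then show ?thesis
    by (auto simp: L_Sym_def id_Sym_range)
qed

lemma tensor_act_preserves_Sym:
  fixes \<psi> :: "('n::finite, 'q::finite) tensor"
  assumes "\<psi> \<in> Sym" shows "tensor_act A *v \<psi> \<in> Sym"
proof -
  have *: "(tensor_act A :: ('n, 'q) tensor_op) $ (f \<circ> \<pi>) $ (g \<circ> \<pi>)
      = tensor_act A $ f $ g" if "bij \<pi>" for f g :: "'n \<Rightarrow> 'q" and \<pi> :: "'n \<Rightarrow> 'n"
  proof -
    have "(\<Prod>l\<in>UNIV - {k}. mat 1 $ f (\<pi> l) $ g (\<pi> l) :: complex)
        = (\<Prod>l\<in>UNIV - {\<pi> k}. mat 1 $ f l $ g l)" for k
    proof (rule prod.reindex_bij_betw[where h = \<pi>])
      show "bij_betw \<pi> (UNIV - {k}) (UNIV - {\<pi> k})"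
        using that by (auto simp: bij_betw_def inj_on_def bij_def image_iff)
    qed
    then show ?thesis
      using sum.reindex_bij_betw[OF that,
          of "\<lambda>k. A $ f k $ g k * (\<Prod>l\<in>UNIV - {k}. mat 1 $ f l $ g l)"]
      by (simp add: tensor_act_def)
  qed
  have "(\<Sum>g\<in>UNIV. tensor_act A $ (f \<circ> \<pi>) $ g * \<psi> $ g) = (\<Sum>g\<in>UNIV. tensor_act A $ f $ g * \<psi> $ g)"
    if "bij \<pi>" for f :: "'n \<Rightarrow> 'q" and \<pi> :: "'n \<Rightarrow> 'n"
    using sum_bij_comp[OF that, of "\<lambda>g. tensor_act A $ (f \<circ> \<pi>) $ g * \<psi> $ g"] assms that
    by (simp add: * Sym_def)
  then show ?thesis
    by (simp add: Sym_def matrix_vector_mult_def)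
qed

lemma sym_act_on_Sym:
  "sym_act A \<in> L_Sym" and "\<psi> \<in> Sym \<Longrightarrow> sym_act A *v \<psi> = tensor_act A *v \<psi>"
  using id_Sym_in_L_Sym
  by (auto simp: sym_act_def L_Sym_def id_Sym_acts tensor_act_preserves_Sym
      simp flip: matrix_vector_mul_assoc)

end

(* An operator X on Sym^n(C^q) has matrix entries depending only on the multisets of values of the
   two indices, so it is a kernel x(M, N) on multisets of size n.  Put
     (lower x)(M, N) = sum_i x(M + i, N + i),   (raise x)(M, N) = sum_i M_i N_i x(M - i, N - i);
   under the symbol map to polynomials in z, w these are sum_i d/dz_i d/dw_i and multiplication by
   z . w, and they satisfy an sl_2 relation: lower raise - raise lower is the scalar 2n + q on
   kernels of size n.  Left multiplication by su(q) fits together with powers of raise so that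
   E_k is the image of raise^(n-k), and the sl_2 relation yields the eigenvalue lambda_k(t) of
   D_k = raise^k lower^k on V_t.

   D_k can be written as sum_U c <U, X> U over an explicit family of operators U.  Replacing
   <U, X> U by U X U* turns the orthogonal projection onto V_t into Phi_t, and it turns D_(n-k)
   into ((n-k)!/k!)^2 D_k.  Hence, on V_j,
     sum_(t <= k) lambda_(n-k)(t) W_t(j) = ((n-k)!/k!)^2 lambda_k(j)   for all k <= n,
   and this triangular system is solved by an alternating sum that telescopes. *)

theory Submission
  imports Defs
begin

text \<open>Phi_t is quadratic in the elements of a basis of V_t, and no explicit orthonormal basis
  is at hand. But Phi_t and the projection onto V_t are two contractions of one tensor, the sum of E
  \<otimes> conj E, so any other family of operators with the same tensor may replace the bases. The
  ladders, \<open>raise\<close>^m applied to matrix units, form such a family for D_m, a combination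
  of the projections. A ladder fixes k = n - m letters of each index and sums over m common ones;
  replacing <U, X> U by U X U* trades these two roles, which is why D_(n-k) becomes D_k. The factors
  (n-k)! and k! only record that words of these lengths, not multisets, are summed. Below, the
  symbol of x is the polynomial with coefficient x(M, N) / (M! N!) at z^M w^N. In these terms V_t is
  (z . w)^(n-t) times the harmonic polynomials of bidegree (t, t). The coefficients are unique only
  because each V_j is nonzero, which the harmonic polynomial z_a^j w_b^j with a \<noteq> b
  exhibits.\<close>

section \<open>Kernels on multisets\<close>

text \<open>Sums over multisets of size \<open>n\<close> are taken over words, which counts each multiset \<open>M\<close>
  with its multinomial coefficient \<open>n! / M!\<close>.\<close>

definition words :: "nat \<Rightarrow> 'a list set" where
  "words n = {I. length I = n}"

lemma finite_words [simp]: "finite (words n :: 'a::finite list set)"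
  using finite_lists_length_eq[of "UNIV :: 'a set" n] by (simp add: words_def)

lemma sum_words_0 [simp]: "sum h (words 0) = h []"
  by (simp add: words_def)

lemma sum_words_Suc:
  "sum h (words (Suc n)) = (\<Sum>i\<in>UNIV. \<Sum>I\<in>words n. h (i # I))" for h :: "'a::finite list \<Rightarrow> 'b::comm_monoid_add"
proof -
  have "(words (Suc n) :: 'a list set) = (\<lambda>(i, I). i # I) ` (UNIV \<times> words n)"
    by (auto simp: words_def length_Suc_conv image_iff)
  moreover have "inj_on (\<lambda>(i, I). i # I) (UNIV \<times> (words n :: 'a list set))"
    by (auto simp: inj_on_def)
  ultimately have "sum h (words (Suc n)) = (\<Sum>(i, I)\<in>UNIV \<times> words n. h (i # I))"
    by (simp only: sum.reindex) (simp add: case_prod_unfold)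
  then show ?thesis
    by (simp add: sum.cartesian_product)
qed

lemma size_mset_words: "I \<in> words n \<Longrightarrow> size (mset I) = n"
  by (simp add: words_def)

lemma sum_count: "(\<Sum>i\<in>UNIV. count M i) = size M" for M :: "'a::finite multiset"
  unfolding size_multiset_overloaded_eq
  by (rule sum.mono_neutral_right) (auto simp: not_in_iff)

text \<open>The weight M! cancels the n!/M! words that represent M, so summing against this kernel
  over words acts as n! times the identity (\<open>sum_idker\<close>). Its symbol as a function of M
  alone is z^N.\<close>

definition idker :: "'a::finite multiset \<Rightarrow> 'a multiset \<Rightarrow> complex" where
  "idker M N = (if M = N then (\<Prod>i\<in>UNIV. fact (count M i)) else 0)"

lemma idker_remove:
  "of_nat (count M i) * idker (M - {#i#}) P = idker M (add_mset i P)"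
proof (cases "i \<in># M")
  case False
  then show ?thesis
    by (auto simp: idker_def not_in_iff)
next
  case True
  then obtain M' where M: "M = add_mset i M'"
    by (metis insert_DiffM)
  have "(\<Prod>j\<in>UNIV. fact (count M j)) = fact (Suc (count M' i)) * (\<Prod>j\<in>UNIV - {i}. fact (count M j) :: complex)"
    by (subst prod.remove[of _ i]) (auto simp: M)
  also have "(\<Prod>j\<in>UNIV - {i}. fact (count M j) :: complex) = (\<Prod>j\<in>UNIV - {i}. fact (count M' j))"
    by (rule prod.cong) (auto simp: M)
  also have "fact (Suc (count M' i)) * \<dots> = of_nat (count M i) * (\<Prod>j\<in>UNIV. fact (count M' j) :: complex)"
    by (subst (2) prod.remove[of _ i]) (auto simp: M algebra_simps)
  finally show ?thesis
    by (auto simp: idker_def M)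
qed

lemma sum_idker:
  "size M = n \<Longrightarrow> (\<Sum>K\<in>words n. idker M (mset K) * h (mset K)) = fact n * h M"
proof (induction n arbitrary: M h)
  case 0
  then show ?case by (simp add: idker_def)
next
  case (Suc n)
  have *: "of_nat (count M i) * (\<Sum>K\<in>words n. idker (M - {#i#}) (mset K) * h (add_mset i (mset K)))
      = of_nat (count M i) * (fact n * h M)" for i
  proof (cases "i \<in># M")
    case True
    then have "size (M - {#i#}) = n" "add_mset i (M - {#i#}) = M"
      using Suc.prems by (simp_all add: size_Diff_singleton)
    with Suc.IH[of "M - {#i#}" "\<lambda>K. h (add_mset i K)"] show ?thesis
      by simp
  qed (simp add: not_in_iff)
  have "(\<Sum>K\<in>words (Suc n). idker M (mset K) * h (mset K))
      = (\<Sum>i\<in>UNIV. of_nat (count M i) * (\<Sum>K\<in>words n. idker (M - {#i#}) (mset K) * h (add_mset i (mset K))))"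
    by (simp add: sum_words_Suc sum_distrib_left idker_remove flip: mult.assoc)
  also have "\<dots> = (\<Sum>i\<in>UNIV. of_nat (count M i)) * (fact n * h M)"
    by (simp only: * sum_distrib_right)
  also have "\<dots> = fact (Suc n) * h M"
    using Suc.prems by (simp add: sum_count flip: of_nat_sum)
  finally show ?case .
qed

lemma idker_sym: "idker M N = idker N M"
  by (auto simp: idker_def)

lemma cnj_idker [simp]: "cnj (idker M N) = idker M N"
  by (simp add: idker_def)

section \<open>Raising and lowering of kernels and their sl_2 relation\<close>

type_synonym 'a kernel = "'a multiset \<Rightarrow> 'a multiset \<Rightarrow> complex"

definition lower :: "'a::finite kernel \<Rightarrow> 'a kernel" where
  "lower x M N = (\<Sum>i\<in>UNIV. x (add_mset i M) (add_mset i N))"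

definition raise :: "'a::finite kernel \<Rightarrow> 'a kernel" where
  "raise x M N = (\<Sum>i\<in>UNIV. of_nat (count M i) * of_nat (count N i) * x (M - {#i#}) (N - {#i#}))"

text \<open>The kernel with symbol (z . w)^m z^P w^Q, that is, \<open>raise\<close>^m of the matrix
  unit at (P, Q) (\<open>raise_pow_ladder\<close>).\<close>

definition ladder :: "nat \<Rightarrow> 'a multiset \<Rightarrow> 'a multiset \<Rightarrow> 'a::finite kernel" where
  "ladder m P Q M N = (\<Sum>J\<in>words m. idker M (P + mset J) * idker N (Q + mset J))"

text \<open>Terms with i missing from M or N have weight zero, so only arguments one size smaller
  are seen. Sizes must be tracked through every induction because the scalar of the sl_2 relation
  depends on them.\<close>

lemma raise_cong:
  assumes "\<And>M' N'. Suc (size M') = size M \<Longrightarrow> Suc (size N') = size N \<Longrightarrow> x M' N' = y M' N'"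
  shows "raise x M N = raise y M N"
  unfolding raise_def
proof (rule sum.cong[OF refl])
  fix i
  show "of_nat (count M i) * of_nat (count N i) * x (M - {#i#}) (N - {#i#}) =
      of_nat (count M i) * of_nat (count N i) * y (M - {#i#}) (N - {#i#})"
  proof (cases "i \<in># M \<and> i \<in># N")
    case True
    then have "Suc (size (M - {#i#})) = size M" "Suc (size (N - {#i#})) = size N"
      by (metis insert_DiffM size_add_mset)+
    then show ?thesis by (simp add: assms)
  qed (auto simp: not_in_iff)
qed

lemma raise_add: "raise (\<lambda>M N. x M N + y M N) M N = raise x M N + raise y M N"
  by (simp add: raise_def algebra_simps sum.distrib)

lemma raise_scale: "raise (\<lambda>M N. c * x M N) M N = c * raise x M N"
  by (simp add: raise_def sum_distrib_left algebra_simps)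

lemma raise_sum: "raise (\<lambda>M N. \<Sum>a\<in>S. x a M N) M N = (\<Sum>a\<in>S. raise (x a) M N)"
  by (simp add: raise_def sum_distrib_left sum.swap[of _ _ S])

lemma raise_ladder: "raise (ladder m P Q) M N = ladder (Suc m) P Q M N"
  unfolding ladder_def raise_sum sum_words_Suc
  by (subst sum.swap) (simp add: raise_def flip: idker_remove add: mult_ac)

text \<open>Expands y into matrix units and raises each of them; one factor 1/k! for each index
  compensates for summing over words.\<close>

lemma raise_pow:
  "size M = k + m \<Longrightarrow> size N = k + m \<Longrightarrow> (raise ^^ m) y M N =
     (\<Sum>P\<in>words k. \<Sum>Q\<in>words k. y (mset P) (mset Q) / (fact k)\<^sup>2 * ladder m (mset P) (mset Q) M N)"
proof (induction m arbitrary: M N)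
  case 0
  have "(\<Sum>P\<in>words k. \<Sum>Q\<in>words k. y (mset P) (mset Q) / (fact k)\<^sup>2 * ladder 0 (mset P) (mset Q) M N)
     = (\<Sum>P\<in>words k. idker M (mset P) * (\<Sum>Q\<in>words k. idker N (mset Q) * (y (mset P) (mset Q) / (fact k)\<^sup>2)))"
    by (simp add: ladder_def sum_distrib_left mult_ac)
  also have "\<dots> = y M N"
    using 0 sum_idker[of N k "\<lambda>Q. y (mset P) Q / (fact k)\<^sup>2" for P]
      sum_idker[of M k "\<lambda>P. y P N / fact k"]
    by (simp add: power2_eq_square)
  finally show ?case by simp
next
  case (Suc m)
  have "(raise ^^ Suc m) y M N = raise ((raise ^^ m) y) M N"
    by simp
  also have "\<dots> = raise (\<lambda>M N. \<Sum>P\<in>words k. \<Sum>Q\<in>words k. y (mset P) (mset Q) / (fact k)\<^sup>2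
      * ladder m (mset P) (mset Q) M N) M N"
    using Suc by (intro raise_cong) simp
  finally show ?case
    by (simp only: raise_sum raise_scale raise_ladder)
qed

lemma lower_pow: "(lower ^^ m) x M N = (\<Sum>I\<in>words m. x (M + mset I) (N + mset I))"
  by (induction m arbitrary: M N) (simp_all add: lower_def sum_words_Suc)

lemma lower_raise:
  "lower (raise x) M N = raise (lower x) M N + of_nat (size M + size N + CARD('a)) * x M N"
  for x :: "'a::finite kernel"
proof -
  define t where "t i j = of_nat (count M j) * of_nat (count N j) * x (add_mset i (M - {#j#})) (add_mset i (N - {#j#}))" for i j
  \<comment> \<open>Off the diagonal the two operators commute. For i = j the weight is (M_i +
    1)(N_i + 1) = M_i N_i + (M_i + N_i + 1), and the excess sums over i to the scalar.\<close>
  have *: "of_nat (count (add_mset i M) j) * of_nat (count (add_mset i N) j) * x (add_mset i M - {#j#}) (add_mset i N - {#j#})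
     = t i j + (if i = j then of_nat (count M i + count N i + 1) * x M N else 0)" for i j
  proof (cases "j \<in># M \<and> j \<in># N")
    case True
    then show ?thesis
      by (auto simp: t_def algebra_simps)
  next
    case False
    then show ?thesis
      by (auto simp: t_def not_in_iff algebra_simps)
  qed
  have "lower (raise x) M N = (\<Sum>i\<in>UNIV. \<Sum>j\<in>UNIV. t i j) + (\<Sum>i\<in>UNIV. of_nat (count M i + count N i + 1) * x M N)"
    unfolding lower_def raise_def * by (simp add: sum.distrib)
  also have "(\<Sum>i\<in>UNIV. \<Sum>j\<in>UNIV. t i j) = raise (lower x) M N"
    by (subst sum.swap) (simp add: raise_def lower_def t_def sum_distrib_left)
  also have "(\<Sum>i\<in>UNIV. of_nat (count M i + count N i + 1) * x M N) = of_nat (size M + size N + CARD('a)) * x M N"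
    unfolding sum_distrib_right[symmetric] of_nat_sum[symmetric]
    by (simp only: sum.distrib sum_count) simp
  finally show ?thesis .
qed

text \<open>Here s is the size at which the result is evaluated. Passing \<open>lower\<close>
  through m copies of \<open>raise\<close> collects 2(s - i) + q for i < m, one size less each time,
  with total m(2s + q + 1 - m).\<close>

lemma lower_raise_pow:
  fixes x :: "'a::finite kernel"
  shows "size M = s \<Longrightarrow> size N = s \<Longrightarrow> lower ((raise ^^ m) x) M N = (raise ^^ m) (lower x) M N
    + of_nat m * (2 * of_nat s + of_nat CARD('a) + 1 - of_nat m) * (raise ^^ (m - 1)) x M N"
proof (induction m arbitrary: M N s)
  case 0
  then show ?case by simp
next
  case (Suc m)
  define c :: complex where "c = of_nat m * (2 * of_nat s + of_nat CARD('a) - 1 - of_nat m)"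
  have "lower ((raise ^^ Suc m) x) M N = raise (lower ((raise ^^ m) x)) M N
      + (2 * of_nat s + of_nat CARD('a)) * (raise ^^ m) x M N"
    using Suc.prems by (simp add: lower_raise)
  also have "raise (lower ((raise ^^ m) x)) M N
      = raise (\<lambda>M N. (raise ^^ m) (lower x) M N + c * (raise ^^ (m - 1)) x M N) M N"
  proof (intro raise_cong)
    fix M' N' :: "'a multiset" assume "Suc (size M') = size M" "Suc (size N') = size N"
    then have "size M' = s - 1" "size N' = s - 1" "of_nat (s - 1) = (of_nat s - 1 :: complex)"
      using Suc.prems by auto
    then show "lower ((raise ^^ m) x) M' N' = (raise ^^ m) (lower x) M' N' + c * (raise ^^ (m - 1)) x M' N'"
      using Suc.IH[of M' "s - 1" N'] by (simp only: c_def) (simp add: algebra_simps)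
  qed
  also have "\<dots> = (raise ^^ Suc m) (lower x) M N + c * (raise ^^ m) x M N"
    by (cases m) (simp_all add: raise_add raise_scale c_def)
  finally show ?case
    by (simp add: c_def algebra_simps)
qed

section \<open>The gl(q) action on kernels and its commutator with powers of
  \<open>raise\<close>\<close>

definition shift :: "'a \<Rightarrow> 'a \<Rightarrow> 'a kernel \<Rightarrow> 'a kernel" where
  "shift b a x M N = of_nat (count M b) * x (add_mset a (M - {#b#})) N"

text \<open>On symbols, \<open>shift b a\<close> is z_b d/dz_a and \<open>ins b a\<close> is
  multiplication by z_b w_a, the commutator of \<open>shift b a\<close> with multiplication by z .
  w.\<close>

definition ins :: "'a \<Rightarrow> 'a \<Rightarrow> 'a kernel \<Rightarrow> 'a kernel" where
  "ins b a x M N = of_nat (count M b) * of_nat (count N a) * x (M - {#b#}) (N - {#a#})"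

lemma count_remove_mult: "count M i * count (M - {#i#}) b = count M b * count (M - {#b#}) i"
  by (cases "i = b") (auto simp: algebra_simps)

lemma ins_raise: "ins b a (raise y) M N = raise (ins b a y) M N"
proof -
  have "of_nat (count M b) * of_nat (count N a) * (of_nat (count (M - {#b#}) i) * of_nat (count (N - {#a#}) i) * z)
     = of_nat (count M i) * of_nat (count N i) * (of_nat (count (M - {#i#}) b) * of_nat (count (N - {#i#}) a) * z)"
    for i and z :: complex
    using arg_cong[OF count_remove_mult[of M i b], of "of_nat :: _ \<Rightarrow> complex"]
      arg_cong[OF count_remove_mult[of N i a], of "of_nat :: _ \<Rightarrow> complex"]
    by (simp add: mult_ac)
  from this[of _ "y (M - {#b#} - {#_#}) (N - {#a#} - {#_#})"] show ?thesis
    unfolding ins_def raise_def sum_distrib_left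
    by (intro sum.cong refl) (simp only: diff_right_commute)
qed

lemma shift_raise: "shift b a (raise y) M N = raise (shift b a y) M N + ins b a y M N"
proof -
  have *: "of_nat (count M b) * (of_nat (count (add_mset a (M - {#b#})) i) * of_nat (count N i) * y (add_mset a (M - {#b#}) - {#i#}) (N - {#i#}))
     = of_nat (count M i) * of_nat (count N i) * (of_nat (count (M - {#i#}) b) * y (add_mset a (M - {#i#} - {#b#})) (N - {#i#}))
     + (if i = a then ins b a y M N else 0)" for i
  proof -
    have 1: "of_nat (count M i) * of_nat (count (M - {#i#}) b) = (of_nat (count M b) * of_nat (count (M - {#b#}) i) :: complex)"
      using count_remove_mult[of M i b] by (metis of_nat_mult)
    have 2: "of_nat (count (M - {#b#}) i) * y (add_mset a (M - {#b#}) - {#i#}) N' = 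
      of_nat (count (M - {#b#}) i) * y (add_mset a (M - {#b#} - {#i#})) N'" for N'
      by (cases "i \<in># M - {#b#}") (auto simp: not_in_iff)
    have "of_nat (count M b) * (of_nat (count (add_mset a (M - {#b#})) i) * of_nat (count N i) * y (add_mset a (M - {#b#}) - {#i#}) (N - {#i#}))
      = of_nat (count M b) * of_nat (count N i) * (of_nat (count (M - {#b#}) i) * y (add_mset a (M - {#b#}) - {#i#}) (N - {#i#}))
      + (if i = a then ins b a y M N else 0)"
      by (simp add: ins_def algebra_simps)
    also have "of_nat (count M b) * of_nat (count N i) * (of_nat (count (M - {#b#}) i) * y (add_mset a (M - {#b#}) - {#i#}) (N - {#i#}))
      = (of_nat (count M b) * of_nat (count (M - {#b#}) i)) * of_nat (count N i) * y (add_mset a (M - {#b#} - {#i#})) (N - {#i#})"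
      by (subst 2) (simp only: mult_ac)
    finally show ?thesis
      by (simp only: 1[symmetric] mult_ac diff_right_commute)
  qed
  show ?thesis
    unfolding shift_def raise_def sum_distrib_left * by (simp add: sum.distrib)
qed

lemma ins_raise_pow: "ins b a ((raise ^^ m) y) = (raise ^^ m) (ins b a y)"
proof (induction m)
  case (Suc m)
  have "ins b a (raise z) = raise (ins b a z)" for z
    by (simp add: fun_eq_iff ins_raise)
  with Suc show ?case by simp
qed simp

lemma shift_raise_pow:
  "shift b a ((raise ^^ m) y) M N = (raise ^^ m) (shift b a y) M N + of_nat m * (raise ^^ (m - 1)) (ins b a y) M N"
proof (induction m arbitrary: M N)
  case (Suc m)
  have "shift b a ((raise ^^ Suc m) y) M N = raise (shift b a ((raise ^^ m) y)) M N + (raise ^^ m) (ins b a y) M N"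
    by (simp add: shift_raise ins_raise_pow)
  also have "raise (shift b a ((raise ^^ m) y)) M N
     = raise (\<lambda>M N. (raise ^^ m) (shift b a y) M N + of_nat m * (raise ^^ (m - 1)) (ins b a y) M N) M N"
    by (rule raise_cong) (rule Suc)
  also have "\<dots> = (raise ^^ Suc m) (shift b a y) M N + of_nat m * (raise ^^ m) (ins b a y) M N"
    by (cases m) (simp_all add: raise_add raise_scale)
  finally show ?case by (simp add: algebra_simps)
qed simp

section \<open>Operators on the symmetric power as kernels\<close>

definition slots :: "('n::finite \<Rightarrow> 'q) \<Rightarrow> 'q multiset" where
  "slots f = image_mset f (mset_set UNIV)"

lemma size_slots [simp]: "size (slots f) = CARD('n)" for f :: "'n::finite \<Rightarrow> 'q"
  by (simp add: slots_def)

lemma slots_bij: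
  "\<exists>e :: ('n::finite \<Rightarrow> 'q::finite) \<Rightarrow> 'q list.
    bij_betw e UNIV (words CARD('n)) \<and> (\<forall>f. slots f = mset (e f))"
proof -
  obtain xs where xs: "set xs = (UNIV :: 'n set)" "distinct xs"
    using finite_distinct_list[OF finite_class.finite_UNIV] by blast
  then have len: "length xs = CARD('n)"
    by (metis distinct_card)
  let ?e = "\<lambda>f :: 'n \<Rightarrow> 'q. map f xs"
  have inj: "inj ?e"
    using xs by (auto simp: inj_on_def fun_eq_iff)
  have "range ?e = words CARD('n)"
  proof (rule card_subset_eq)
    show "range ?e \<subseteq> words CARD('n)"
      by (auto simp: words_def len)
    have "card (range ?e) = CARD('q) ^ CARD('n)"
      using inj by (simp add: card_image card_fun)
    also have "\<dots> = card (words CARD('n) :: 'q list set)"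
      using card_lists_length_eq[of "UNIV :: 'q set" "CARD('n)"] by (simp add: words_def)
    finally show "card (range ?e) = card (words CARD('n) :: 'q list set)" .
  qed simp
  with inj have "bij_betw ?e UNIV (words CARD('n))"
    by (simp add: bij_betw_def)
  moreover have "slots f = mset (?e f)" for f
    using xs by (simp add: slots_def flip: mset_set_set)
  ultimately show ?thesis
    by blast
qed

lemma sum_slots:
  "(\<Sum>f\<in>(UNIV :: ('n::finite \<Rightarrow> 'q::finite) set). h (slots f)) = (\<Sum>I\<in>words CARD('n). h (mset I))"
proof -
  obtain e where e: "bij_betw e (UNIV :: ('n \<Rightarrow> 'q) set) (words CARD('n))"
    and "\<And>f. slots f = mset (e f)"
    using slots_bij by blast
  then show ?thesis
    using sum.reindex_bij_betw[OF e, of "\<lambda>I. h (mset I)"] by simp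
qed

lemma ex_slots:
  assumes "size M = CARD('n)"
  shows "\<exists>f :: 'n::finite \<Rightarrow> 'q::finite. slots f = M"
proof -
  obtain e where e: "bij_betw e (UNIV :: ('n \<Rightarrow> 'q) set) (words CARD('n))"
    and *: "\<And>f. slots f = mset (e f)"
    using slots_bij by blast
  obtain I where I: "mset I = M"
    using ex_mset by blast
  then have "I \<in> words CARD('n)"
    using assms by (auto simp: words_def)
  with e have "I \<in> range e"
    by (simp add: bij_betw_def)
  then obtain f where "e f = I"
    by blast
  with * I show ?thesis by blast
qed

lemma slots_comp: "bij \<pi> \<Longrightarrow> slots (f \<circ> \<pi>) = slots f"
  for f :: "'n::finite \<Rightarrow> 'q"
  by (simp add: slots_def bij_is_inj bij_is_surj image_mset_mset_set flip: multiset.map_comp)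

lemma slots_eqD:
  fixes f g :: "'n::finite \<Rightarrow> 'q"
  assumes "slots f = slots g"
  obtains \<pi> where "bij \<pi>" "f = g \<circ> \<pi>"
proof -
  from assms have "image_mset f (mset_set UNIV) = image_mset g (mset_set UNIV)"
    by (simp add: slots_def)
  then obtain p where "p permutes UNIV" "\<forall>x\<in>UNIV. f x = g (p x)"
    by (rule image_mset_eq_implies_permutes[OF finite_class.finite_UNIV])
  then show ?thesis
    by (intro that[of p]) (auto simp: permutes_bij fun_eq_iff)
qed

lemma slots_upd: "slots (f(k := a)) = add_mset a (slots f - {#f k#})"
  for f :: "'n::finite \<Rightarrow> 'q"
proof -
  have "slots g = add_mset (g k) (image_mset g (mset_set (UNIV - {k})))" for g :: "'n \<Rightarrow> 'q"
    by (simp add: slots_def mset_set.remove[of UNIV k])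
  moreover have "image_mset (f(k := a)) (mset_set (UNIV - {k})) = image_mset f (mset_set (UNIV - {k}))"
    by (rule image_mset_cong) auto
  ultimately show ?thesis by simp
qed

lemma sum_over_slots: "(\<Sum>k\<in>UNIV. h (f k)) = (\<Sum>b\<in>UNIV. of_nat (count (slots f) b) * h b)"
  for f :: "'n::finite \<Rightarrow> 'q::finite" and h :: "'q \<Rightarrow> complex"
proof -
  have "count (slots f) b = card {k. f k = b}" for b
    by (simp add: slots_def count_image_mset' count_mset_set' if_distrib sum.If_cases Int_def eq_commute)
  then have "(\<Sum>b\<in>UNIV. of_nat (count (slots f) b) * h b) = (\<Sum>b\<in>UNIV. \<Sum>k | f k = b. h (f k))"
    by simp
  also have "\<dots> = (\<Sum>k\<in>UNIV. h (f k))"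
    using sum.group[of UNIV UNIV f "\<lambda>k. h (f k)"] by simp
  finally show ?thesis by simp
qed

definition op_of :: "'q::finite kernel \<Rightarrow> ('n::finite, 'q) tensor_op" where
  "op_of x = (\<chi> f g. x (slots f) (slots g))"

lemma op_of_nth [simp]: "op_of x $ f $ g = x (slots f) (slots g)"
  by (simp add: op_of_def)

lemma op_of_cong:
  assumes "\<And>M N. size M = CARD('n) \<Longrightarrow> size N = CARD('n) \<Longrightarrow> x M N = y M N"
  shows "op_of x = (op_of y :: ('n::finite, 'q::finite) tensor_op)"
  by (simp add: vec_eq_iff assms)

lemma cscale_nth [simp]: "cscale c X $ i $ j = c * X $ i $ j"
  by (simp add: cscale_def)

lemma adj_nth [simp]: "adj X $ i $ j = cnj (X $ j $ i)"
  by (simp add: adj_def transpose_def)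

lemma sum_nth2: "(\<Sum>a\<in>S. X a) $ i $ j = (\<Sum>a\<in>S. X a $ i $ j)"
  by (simp add: sum_component)

lemma hs_inner_alt: "hs_inner X Y = (\<Sum>i\<in>UNIV. \<Sum>j\<in>UNIV. cnj (X $ i $ j) * Y $ i $ j)"
  unfolding hs_inner_def trace_def matrix_matrix_mult_def
  by (simp, rule sum.swap)

lemma op_of_sum: "(\<Sum>a\<in>S. op_of (x a)) = op_of (\<lambda>M N. \<Sum>a\<in>S. x a M N)"
  by (simp add: vec_eq_iff sum_nth2)

lemma cscale_op_of: "cscale c (op_of x) = op_of (\<lambda>M N. c * x M N)"
  by (simp add: vec_eq_iff)

lemma op_of_add: "op_of x + op_of y = op_of (\<lambda>M N. x M N + y M N)"
  by (simp add: vec_eq_iff)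

lemma adj_op_of: "adj (op_of x) = op_of (\<lambda>M N. cnj (x N M))"
  by (simp add: vec_eq_iff)

lemma op_of_mult:
  "(op_of x :: ('n::finite, 'q::finite) tensor_op) ** op_of y =
    op_of (\<lambda>M N. \<Sum>K\<in>words CARD('n). x M (mset K) * y (mset K) N)"
  by (simp add: vec_eq_iff matrix_matrix_mult_def
      sum_slots[where h = "\<lambda>K. x M K * y K N" for M N])

lemma hs_inner_op_of:
  "hs_inner (op_of x :: ('n::finite, 'q::finite) tensor_op) (op_of y) =
    (\<Sum>K\<in>words CARD('n). \<Sum>L\<in>words CARD('n). cnj (x (mset K) (mset L)) * y (mset K) (mset L))"
  by (simp add: hs_inner_alt sum_slots[where h = "\<lambda>L. cnj (x K L) * y K L" for K]
      sum_slots[where h = "\<lambda>K. \<Sum>L\<in>words CARD('n). cnj (x K (mset L)) * y K (mset L)"])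

lemma op_of_in_L_Sym: "(op_of x :: ('n::finite, 'q::finite) tensor_op) \<in> L_Sym"
proof -
  have "op_of x *v \<psi> = 0" if "\<forall>\<xi>\<in>Sym. cinner \<xi> \<psi> = 0" for \<psi> :: "('n::finite, 'q::finite) tensor"
  proof -
    have "(op_of x *v \<psi>) $ f = cinner (\<chi> g. cnj (x (slots f) (slots g))) \<psi>" for f
      by (simp add: matrix_vector_mult_def cinner_def)
    moreover have "(\<chi> g. cnj (x (slots f) (slots g))) \<in> Sym" for f :: "'n \<Rightarrow> 'q"
      by (simp add: Sym_def slots_comp)
    ultimately show ?thesis
      using that by (simp only: vec_eq_iff zero_index) blast
  qed
  then show ?thesis
    by (simp add: L_Sym_def Sym_def matrix_vector_mult_def slots_comp)
qed

text \<open>A range inside \<open>Sym\<close> makes the entries invariant under permuting the row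
  index. Vanishing on the complement does the same for the column index, since the difference of two
  basis vectors with permuted indices is orthogonal to \<open>Sym\<close>. Indices with the same
  multiset are exactly the permuted ones.\<close>

lemma L_SymE:
  fixes X :: "('n::finite, 'q::finite) tensor_op"
  assumes "X \<in> L_Sym"
  obtains x where "X = op_of x"
proof -
  have col: "(X *v axis g 1) $ f = X $ f $ g" for f g
    by (simp add: matrix_vector_mult_def axis_def if_distrib cong: if_cong)
  have 1: "X $ (f \<circ> \<pi>) $ g = X $ f $ g" if "bij \<pi>" for f g \<pi>
    using assms that unfolding L_Sym_def Sym_def by (simp flip: col)
  have 2: "X $ f $ (g \<circ> \<pi>) = X $ f $ g" if "bij \<pi>" for f g \<pi>
  proof -
    have "cinner \<xi> (axis (g \<circ> \<pi>) 1 - axis g 1) = 0" if "\<xi> \<in> Sym" for \<xi>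
    proof -
      have "cinner \<xi> (axis (g \<circ> \<pi>) 1 - axis g 1) = cnj (\<xi> $ (g \<circ> \<pi>)) - cnj (\<xi> $ g)"
        by (simp add: cinner_def axis_def right_diff_distrib sum_subtractf
            if_distrib[of "\<lambda>z. _ * z"] cong: if_cong)
      with that \<open>bij \<pi>\<close> show ?thesis
        by (simp add: Sym_def)
    qed
    with assms have "X *v (axis (g \<circ> \<pi>) 1 - axis g 1) = 0"
      by (simp add: L_Sym_def)
    then show ?thesis
      by (simp add: matrix_vector_mult_diff_distrib vec_eq_iff col)
  qed
  have 3: "X $ f $ g = X $ f' $ g'" if "slots f = slots f'" "slots g = slots g'" for f f' g g'
    using that by (metis 1 2 slots_eqD)
  define r where "r M = (SOME f :: 'n \<Rightarrow> 'q. slots f = M)" for M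
  have "slots (r (slots f)) = slots f" for f :: "'n \<Rightarrow> 'q"
    unfolding r_def by (rule someI[where P = "\<lambda>h. slots h = slots f" and x = f, OF refl])
  then have "X = op_of (\<lambda>M N. X $ r M $ r N)"
    by (simp add: vec_eq_iff) (metis 3)
  then show ?thesis
    by (rule that)
qed

lemma id_Sym_mult_op_of: "id_Sym ** op_of x = (op_of x :: ('n::finite, 'q::finite) tensor_op)"
proof -
  have "id_Sym *v (op_of x *v \<psi>) = (op_of x *v \<psi> :: ('n, 'q) tensor)" for \<psi>
    using op_of_in_L_Sym[of x, where 'n='n] unfolding L_Sym_def by (intro id_Sym_acts) blast
  then show ?thesis
    by (subst matrix_eq) (simp add: matrix_vector_mul_assoc)
qed

text \<open>\<open>id_Sym\<close> is a left unit for the operators \<open>op_of x\<close> and the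
  normalised \<open>idker\<close> is a right unit, so they agree; no permutations have to be
  counted.\<close>

lemma id_Sym_eq: "id_Sym = (op_of (\<lambda>M N. idker M N / fact CARD('n)) :: ('n::finite, 'q::finite) tensor_op)"
    (is "_ = ?J")
proof -
  have right: "op_of x ** ?J = op_of x" for x :: "'q kernel"
  proof -
    have "(\<Sum>K\<in>words CARD('n). x M (mset K) * (idker (mset K) N / fact CARD('n))) = x M N"
      if "size N = CARD('n)" for M N
      using sum_idker[OF that, of "\<lambda>K. x M K / fact CARD('n)"]
      by (simp add: idker_sym mult_ac)
    then show ?thesis
      unfolding op_of_mult by (intro op_of_cong) simp
  qed
  obtain e where "id_Sym = (op_of e :: ('n, 'q) tensor_op)"
    using L_SymE[OF id_Sym_in_L_Sym] by blast
  with right[of e] id_Sym_mult_op_of show ?thesis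
    by metis
qed

lemma tensor_act_op_of:
  "tensor_act A ** (op_of x :: ('n::finite, 'q::finite) tensor_op) =
    op_of (\<lambda>M N. \<Sum>b\<in>UNIV. \<Sum>a\<in>UNIV. A $ b $ a * shift b a x M N)"
proof -
  have slot: "(\<Sum>h\<in>UNIV. A $ f k $ h k * (\<Prod>l\<in>UNIV - {k}. mat 1 $ f l $ h l) * x (slots h) N)
     = (\<Sum>a\<in>UNIV. A $ f k $ a * x (add_mset a (slots f - {#f k#})) N)" for f :: "'n \<Rightarrow> 'q" and k N
  proof -
    let ?g = "\<lambda>h. A $ f k $ h k * (\<Prod>l\<in>UNIV - {k}. mat 1 $ f l $ h l) * x (slots h) N"
    \<comment> \<open>The factors of the other slots are Kronecker deltas, so only indices that
      differ from f at most in slot k contribute.\<close>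
    have "sum ?g UNIV = sum ?g (range (\<lambda>a. f(k := a)))"
    proof (rule sum.mono_neutral_right)
      show "\<forall>h\<in>UNIV - range (\<lambda>a. f(k := a)). ?g h = 0"
      proof
        fix h assume h: "h \<in> UNIV - range (\<lambda>a. f(k := a))"
        have "\<exists>l. l \<noteq> k \<and> f l \<noteq> h l"
        proof (rule ccontr)
          assume "\<not> ?thesis"
          then have "h = f(k := h k)" by (auto simp: fun_eq_iff)
          with h show False by blast
        qed
        then show "?g h = 0"
          by (auto simp: mat_def)
      qed
    qed auto
    also have "\<dots> = (\<Sum>a\<in>UNIV. ?g (f(k := a)))"
      by (subst sum.reindex) (auto simp: inj_on_def dest: fun_upd_eqD)
    also have "\<dots> = (\<Sum>a\<in>UNIV. A $ f k $ a * x (add_mset a (slots f - {#f k#})) N)"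
      by (intro sum.cong refl) (simp add: slots_upd mat_def)
    finally show ?thesis .
  qed
  have "(tensor_act A ** op_of x) $ f $ g
      = (\<Sum>b\<in>UNIV. \<Sum>a\<in>UNIV. A $ b $ a * shift b a x (slots f) (slots g))" for f g :: "'n \<Rightarrow> 'q"
  proof -
    have "(tensor_act A ** op_of x) $ f $ g
      = (\<Sum>k\<in>UNIV. \<Sum>h\<in>UNIV. A $ f k $ h k * (\<Prod>l\<in>UNIV - {k}. mat 1 $ f l $ h l) * x (slots h) (slots g))"
      by (simp add: matrix_matrix_mult_def tensor_act_def sum_distrib_right) (rule sum.swap)
    also have "\<dots> = (\<Sum>b\<in>UNIV. of_nat (count (slots f) b) * (\<Sum>a\<in>UNIV. A $ b $ a * x (add_mset a (slots f - {#b#})) (slots g)))"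
      unfolding slot by (rule sum_over_slots)
    finally show ?thesis
      by (simp add: shift_def sum_distrib_left mult_ac)
  qed
  then show ?thesis
    by (simp add: vec_eq_iff)
qed

section \<open>The filtration\<close>

lemma hs_inner_add_right: "hs_inner X (Y + Z) = hs_inner X Y + hs_inner X Z"
  by (simp add: hs_inner_alt sum.distrib distrib_left)

lemma hs_inner_cscale_right: "hs_inner X (cscale c Y) = c * hs_inner X Y"
  by (simp add: hs_inner_alt sum_distrib_left mult_ac)

lemma hs_inner_zero [simp]: "hs_inner X 0 = 0" "hs_inner 0 X = 0"
  by (simp_all add: hs_inner_alt)

lemma cnj_hs_inner: "cnj (hs_inner X Y) = hs_inner Y X"
  by (simp add: hs_inner_alt mult.commute)

lemma hs_inner_sum_right: "hs_inner X (\<Sum>a\<in>S. Y a) = (\<Sum>a\<in>S. hs_inner X (Y a))"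
  by (induction S rule: infinite_finite_induct) (simp_all add: hs_inner_add_right)

lemma hs_inner_diff_right: "hs_inner X (Y - Z) = hs_inner X Y - hs_inner X Z"
  by (simp add: hs_inner_alt sum_subtractf right_diff_distrib)

lemma hs_inner_sum_left: "hs_inner (\<Sum>a\<in>S. Y a) X = (\<Sum>a\<in>S. hs_inner (Y a) X)"
  using arg_cong[OF hs_inner_sum_right[of X Y S], of cnj] by (simp add: cnj_hs_inner)

lemma hs_inner_cscale_left: "hs_inner (cscale c Y) X = cnj c * hs_inner Y X"
  using arg_cong[OF hs_inner_cscale_right[of X c Y], of cnj] by (simp add: cnj_hs_inner)

lemma hs_inner_self: "hs_inner X X = of_real (\<Sum>i\<in>UNIV. \<Sum>j\<in>UNIV. (cmod (X $ i $ j))\<^sup>2)"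
  by (simp add: hs_inner_alt complex_norm_square mult.commute flip: of_real_power)

lemma hs_inner_eq_0D:
  assumes "hs_inner X X = 0"
  shows "X = 0"
proof -
  from assms have "(\<Sum>i\<in>UNIV. \<Sum>j\<in>UNIV. (cmod (X $ i $ j))\<^sup>2) = 0"
    by (simp only: hs_inner_self of_real_eq_0_iff)
  then have "X $ i $ j = 0" for i j
    by (simp add: sum_nonneg_eq_0_iff sum_nonneg)
  then show ?thesis
    by (simp add: vec_eq_iff)
qed

lemma mult_cscale_right: "A ** cscale c B = cscale c (A ** B)"
  by (simp add: vec_eq_iff matrix_matrix_mult_def sum_distrib_left mult_ac)

lemma mult_cscale_left: "cscale c A ** B = cscale c (A ** B)"
  by (simp add: vec_eq_iff matrix_matrix_mult_def sum_distrib_left mult_ac)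

lemma raise_pow_add: "(raise ^^ m) (\<lambda>M N. x M N + y M N) M N = (raise ^^ m) x M N + (raise ^^ m) y M N"
proof (induction m arbitrary: M N)
  case (Suc m)
  have "(raise ^^ m) (\<lambda>M N. x M N + y M N) = (\<lambda>M N. (raise ^^ m) x M N + (raise ^^ m) y M N)"
    by (simp add: fun_eq_iff Suc.IH)
  then show ?case by (simp add: raise_add)
qed simp

lemma raise_pow_scale: "(raise ^^ m) (\<lambda>M N. c * x M N) M N = c * (raise ^^ m) x M N"
proof (induction m arbitrary: M N)
  case (Suc m)
  have "(raise ^^ m) (\<lambda>M N. c * x M N) = (\<lambda>M N. c * (raise ^^ m) x M N)"
    by (simp add: fun_eq_iff Suc.IH)
  then show ?case by (simp add: raise_scale)
qed simp

lemma raise_pow_sum: "(raise ^^ m) (\<lambda>M N. \<Sum>a\<in>S. x a M N) M N = (\<Sum>a\<in>S. (raise ^^ m) (x a) M N)"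
proof (induction m arbitrary: M N)
  case (Suc m)
  have "(raise ^^ m) (\<lambda>M N. \<Sum>a\<in>S. x a M N) = (\<lambda>M N. \<Sum>a\<in>S. (raise ^^ m) (x a) M N)"
    by (simp add: fun_eq_iff Suc.IH)
  then show ?case by (simp add: raise_sum)
qed simp

lemma raise_pow_cong:
  assumes "size M = k + m" "size N = k + m"
    and "\<And>P Q. size P = k \<Longrightarrow> size Q = k \<Longrightarrow> x P Q = y P Q"
  shows "(raise ^^ m) x M N = (raise ^^ m) y M N"
  unfolding raise_pow[OF assms(1,2)] using assms(3) by (intro sum.cong refl) (simp add: words_def)

lemma raise_pow_eq_0: "size M < m \<Longrightarrow> (raise ^^ m) y M N = 0"
proof (induction m arbitrary: M N)
  case (Suc m)
  have "(raise ^^ Suc m) y M N = raise (\<lambda>M N. 0) M N"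
    unfolding funpow.simps o_apply by (rule raise_cong) (use Suc in simp)
  also have "\<dots> = 0"
    by (simp add: raise_def)
  finally show ?case .
qed simp

text \<open>For k \<le> n these are the operators whose symbol is divisible by (z . w)^(n-k). The
  kernel y is unrestricted, but only its values at arguments of size k matter
  (\<open>raise_pow_cong\<close>).\<close>

definition filt :: "nat \<Rightarrow> ('n::finite, 'q::finite) tensor_op set" where
  "filt k = range (\<lambda>y. op_of ((raise ^^ (CARD('n) - k)) y))"

lemma subspace_filt: "cmat.subspace (filt k)"
proof (rule cmat.subspaceI)
  show "(0 :: ('n::finite, 'q::finite) tensor_op) \<in> filt k"
    unfolding filt_def
  proof (rule range_eqI)
    \<comment> \<open>The zero kernel is written as a product so that \<open>raise_pow_scale\<close>
      applies to it.\<close>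
    show "(0 :: ('n, 'q) tensor_op) = op_of ((raise ^^ (CARD('n) - k)) (\<lambda>M N. 0 * 0))"
      unfolding vec_eq_iff op_of_nth raise_pow_scale by simp
  qed
next
  fix X Y :: "('n::finite, 'q::finite) tensor_op" assume "X \<in> filt k" "Y \<in> filt k"
  then obtain x y where "X = op_of ((raise ^^ (CARD('n) - k)) x)" "Y = op_of ((raise ^^ (CARD('n) - k)) y)"
    unfolding filt_def by blast
  then have "X + Y = op_of ((raise ^^ (CARD('n) - k)) (\<lambda>M N. x M N + y M N))"
    by (simp add: vec_eq_iff raise_pow_add)
  then show "X + Y \<in> filt k"
    unfolding filt_def by blast
next
  fix c and X :: "('n::finite, 'q::finite) tensor_op" assume "X \<in> filt k"
  then obtain x where "X = op_of ((raise ^^ (CARD('n) - k)) x)"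
    unfolding filt_def by blast
  then have "cscale c X = op_of ((raise ^^ (CARD('n) - k)) (\<lambda>M N. c * x M N))"
    by (simp add: vec_eq_iff raise_pow_scale)
  then show "cscale c X \<in> filt k"
    unfolding filt_def by blast
qed

lemma filt_top: "filt CARD('n) = (L_Sym :: ('n::finite, 'q::finite) tensor_op set)"
proof
  show "filt CARD('n) \<subseteq> (L_Sym :: ('n, 'q) tensor_op set)"
    by (auto simp: filt_def op_of_in_L_Sym)
  show "L_Sym \<subseteq> (filt CARD('n) :: ('n, 'q) tensor_op set)"
    unfolding filt_def by (simp, blast elim: L_SymE)
qed

lemma filt_Suc: 
  assumes "k < CARD('n)"
  shows "filt k \<subseteq> (filt (Suc k) :: ('n::finite, 'q::finite) tensor_op set)"
proof -
  have "CARD('n) - k = Suc (CARD('n) - Suc k)"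
    using assms by simp
  then show ?thesis
    unfolding filt_def by (auto simp: funpow_Suc_right simp del: funpow.simps)
qed

lemma filt_mono: "j \<le> k \<Longrightarrow> k \<le> CARD('n) \<Longrightarrow> filt j \<subseteq> (filt k :: ('n::finite, 'q::finite) tensor_op set)"
proof (induction k rule: dec_induct)
  case (step m)
  then show ?case using filt_Suc[of m, where 'n='n and 'q='q] by simp
qed simp

lemma filt_subset_L_Sym: "filt k \<subseteq> L_Sym"
  by (auto simp: filt_def op_of_in_L_Sym)

lemma filt_0: "filt 0 = (cmat.span {id_Sym} :: ('n::finite, 'q::finite) tensor_op set)"
proof -
  have "op_of ((raise ^^ CARD('n)) y) = cscale ((fact CARD('n))\<^sup>2 * y {#} {#}) (id_Sym :: ('n, 'q) tensor_op)" for y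
  proof -
    have "(raise ^^ CARD('n)) y M N = (fact CARD('n))\<^sup>2 * y {#} {#} * (idker M N / fact CARD('n))"
      if "size M = CARD('n)" "size N = CARD('n)" for M N
      using that sum_idker[of M "CARD('n)" "idker N"]
      by (subst raise_pow[where k = 0]) (simp_all add: ladder_def power2_eq_square idker_sym)
    then show ?thesis
      unfolding id_Sym_eq cscale_op_of by (intro op_of_cong) simp
  qed
  note * = this
  have "cscale c id_Sym \<in> (filt 0 :: ('n, 'q) tensor_op set)" for c
  proof -
    have "cscale c id_Sym = (op_of ((raise ^^ CARD('n)) (\<lambda>_ _. c / (fact CARD('n))\<^sup>2)) :: ('n, 'q) tensor_op)"
      by (simp add: *)
    then show ?thesis
      unfolding filt_def diff_zero by (rule range_eqI[where x = "\<lambda>_ _. c / (fact CARD('n))\<^sup>2"])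
  qed
  moreover have "X \<in> range (\<lambda>c. cscale c id_Sym)" if "X \<in> filt 0" for X :: "('n, 'q) tensor_op"
    using that unfolding filt_def diff_zero * by auto
  ultimately show ?thesis
    unfolding cmat.span_singleton by blast
qed

section \<open>Multiplication by the generators moves the filtration by exactly one step\<close>

lemma sym_act_eq:
  "sym_act A = (op_of (\<lambda>M N. \<Sum>b\<in>UNIV. \<Sum>a\<in>UNIV. A $ b $ a * shift b a (\<lambda>M N. idker M N / fact CARD('n)) M N)
    :: ('n::finite, 'q::finite) tensor_op)"
  unfolding sym_act_def id_Sym_eq tensor_act_op_of ..

lemma sym_act_add: "sym_act (A + B) = sym_act A + sym_act B"
  by (simp add: vec_eq_iff sym_act_eq distrib_right sum.distrib)

lemma sym_act_cscale: "sym_act (cscale c A) = cscale c (sym_act A)"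
  by (simp add: vec_eq_iff sym_act_eq sum_distrib_left mult_ac)

lemma sym_act_one: "sym_act (mat 1) = (cscale (of_nat CARD('n)) id_Sym :: ('n::finite, 'q::finite) tensor_op)"
proof -
  have "(\<Sum>b\<in>UNIV. \<Sum>a\<in>UNIV. mat 1 $ b $ a * shift b a x M N) = of_nat CARD('n) * x M N"
    if "size M = CARD('n)" for M N and x :: "'q kernel"
  proof -
    have "(\<Sum>a\<in>UNIV. mat 1 $ b $ a * shift b a x M N) = of_nat (count M b) * x M N" for b
    proof -
      have "(\<Sum>a\<in>UNIV. mat 1 $ b $ a * shift b a x M N) = (\<Sum>a\<in>UNIV. if a = b then shift b b x M N else 0)"
        by (rule sum.cong) (auto simp: mat_def)
      also have "\<dots> = of_nat (count M b) * x M N"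
        by (cases "b \<in># M") (auto simp: shift_def not_in_iff)
      finally show ?thesis .
    qed
    then show ?thesis
      using that by (simp add: sum_count flip: sum_distrib_right of_nat_sum)
  qed
  then show ?thesis
    unfolding sym_act_eq id_Sym_eq cscale_op_of by (intro op_of_cong) simp
qed

text \<open>The complexification of su(q) is sl(q), and the identity matrix acts as the scalar n, so
  together with \<open>id_Sym\<close> all of gl(q) is reached.\<close>

lemma E_gen_eq: "E_gen = (range sym_act :: ('n::finite, 'q::finite) tensor_op set)"
proof
  have "cmat.subspace (range sym_act :: ('n, 'q) tensor_op set)"
  proof (rule cmat.subspaceI)
    show "0 \<in> (range sym_act :: ('n, 'q) tensor_op set)"
      by (intro range_eqI[of _ _ 0]) (simp add: sym_act_eq vec_eq_iff)
  qed (auto simp flip: sym_act_add sym_act_cscale)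
  moreover have "(id_Sym :: ('n, 'q) tensor_op) = sym_act (cscale (1 / of_nat CARD('n)) (mat 1))"
    by (simp add: sym_act_cscale sym_act_one)
  then have "(id_Sym :: ('n, 'q) tensor_op) \<in> range sym_act"
    by (rule range_eqI)
  then have "insert id_Sym (sym_act ` su) \<subseteq> (range sym_act :: ('n, 'q) tensor_op set)"
    by blast
  ultimately show "E_gen \<subseteq> (range sym_act :: ('n, 'q) tensor_op set)"
    unfolding E_gen_def by (intro cmat.span_minimal)
next
  have su: "sym_act A \<in> (E_gen :: ('n, 'q) tensor_op set)" if "A \<in> su" for A
    using that unfolding E_gen_def by (intro cmat.span_base) blast
  have one: "sym_act (mat 1) \<in> (E_gen :: ('n, 'q) tensor_op set)"
    unfolding E_gen_def sym_act_one by (intro cmat.span_scale cmat.span_base) blast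
  have "sym_act A \<in> (E_gen :: ('n, 'q) tensor_op set)" for A
  proof -
    \<comment> \<open>\<open>A'\<close> is the traceless part of A, \<open>B\<close> its
      skew-Hermitian part and \<open>C\<close> is \<i> times its Hermitian part, so that A' = B -
      \<i> C with both in \<open>su\<close>.\<close>
    define A' where "A' = A - cscale (trace A / of_nat CARD('q)) (mat 1)"
    define B where "B = cscale (1/2) (A' - adj A')"
    define C where "C = cscale (\<i>/2) (A' + adj A')"
    have "trace A' = 0"
      by (simp add: A'_def trace_def sum_subtractf mat_def sum_distrib_left[symmetric])
    then have "trace (adj A') = 0"
      by (simp add: trace_def flip: cnj_sum)
    have trace: "trace (cscale c D) = c * trace D" for c and D :: "complex ^ 'q ^ 'q"
      by (simp add: trace_def sum_distrib_left)
    have "trace B = 0" "trace C = 0"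
      unfolding B_def C_def trace trace_sub trace_add
      using \<open>trace A' = 0\<close> \<open>trace (adj A') = 0\<close> by simp_all
    moreover have "adj B = - B" "adj C = - C"
      by (simp_all add: B_def C_def vec_eq_iff algebra_simps)
    ultimately have "B \<in> su" "C \<in> su"
      by (simp_all add: su_def)
    have "A = cscale (trace A / of_nat CARD('q)) (mat 1) + B + cscale (- \<i>) C"
    proof -
      have "B + cscale (- \<i>) C = A'"
        by (simp add: vec_eq_iff B_def C_def flip: mult.assoc) (simp add: field_simps)
      moreover have "A = cscale (trace A / of_nat CARD('q)) (mat 1) + A'"
        by (simp add: A'_def)
      ultimately show ?thesis
        by (simp only: add.assoc)
    qed
    then have "sym_act A = cscale (trace A / of_nat CARD('q)) (sym_act (mat 1)) + sym_act B + cscale (- \<i>) (sym_act C :: ('n, 'q) tensor_op)"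
      by (metis sym_act_add sym_act_cscale)
    moreover have "\<dots> \<in> E_gen"
      using su[OF \<open>B \<in> su\<close>] su[OF \<open>C \<in> su\<close>] one unfolding E_gen_def
      by (intro cmat.span_add cmat.span_scale)
    ultimately show ?thesis by simp
  qed
  then show "range sym_act \<subseteq> (E_gen :: ('n, 'q) tensor_op set)"
    by blast
qed

lemma sym_act_mult_op_of:
  "sym_act A ** (op_of x :: ('n::finite, 'q::finite) tensor_op) =
    op_of (\<lambda>M N. \<Sum>b\<in>UNIV. \<Sum>a\<in>UNIV. A $ b $ a * shift b a x M N)"
  unfolding sym_act_def tensor_act_op_of[symmetric] by (simp add: id_Sym_mult_op_of flip: matrix_mul_assoc)

text \<open>Acting on (z . w)^(m+1) y, the derivation z_b d/dz_a destroys at most one factor z .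
  w.\<close>

lemma E_gen_mult_filt:
  fixes X Y :: "('n::finite, 'q::finite) tensor_op"
  assumes "k < CARD('n)" "X \<in> E_gen" "Y \<in> filt k"
  shows "X ** Y \<in> filt (Suc k)"
proof -
  define m where "m = CARD('n) - Suc k"
  have m: "CARD('n) - k = Suc m"
    using assms by (simp add: m_def)
  obtain A where A: "X = sym_act A"
    using assms by (auto simp: E_gen_eq)
  obtain y where y: "Y = op_of ((raise ^^ Suc m) y)"
    using assms by (auto simp: filt_def m simp del: funpow.simps)
  define z where "z b a = (\<lambda>M N. raise (shift b a y) M N + of_nat (Suc m) * ins b a y M N)" for b a
  have "shift b a ((raise ^^ Suc m) y) M N = (raise ^^ m) (z b a) M N" for b a M N
    by (simp add: shift_raise_pow z_def raise_pow_add raise_pow_scale funpow_swap1 del: funpow.simps)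
       (simp add: funpow_swap1)
  then have "X ** Y = op_of ((raise ^^ m) (\<lambda>M N. \<Sum>b\<in>UNIV. \<Sum>a\<in>UNIV. A $ b $ a * z b a M N))"
    unfolding A y sym_act_mult_op_of by (intro op_of_cong) (simp add: raise_pow_sum raise_pow_scale del: funpow.simps)
  then show ?thesis
    unfolding filt_def m_def by blast
qed

text \<open>The commutator term (m + 1) z_b w_a (z . w)^m y is the difference of two products with
  elements of \<open>E_gen\<close>, and the polynomials z_b w_a y span everything of bidegree (k +
  1, k + 1).\<close>

lemma filt_Suc_subset_span:
  assumes "k < CARD('n)"
  shows "filt (Suc k) \<subseteq> cmat.span {A ** B | A B. A \<in> E_gen \<and> B \<in> (filt k :: ('n::finite, 'q::finite) tensor_op set)}"
    (is "_ \<subseteq> cmat.span ?G")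
proof
  fix X :: "('n, 'q) tensor_op" assume "X \<in> filt (Suc k)"
  define m where "m = CARD('n) - Suc k"
  have m: "CARD('n) - k = Suc m"
    using assms by (simp add: m_def)
  obtain x where X: "X = op_of ((raise ^^ m) x)"
    using \<open>X \<in> filt (Suc k)\<close> by (auto simp: filt_def m_def)
  \<comment> \<open>On symbols this is the mixed derivative d/dz_b d/dw_a of x over (k + 1)^2; by
    Euler's identity in z and in w, the products z_b w_a y sum to x.\<close>
  define y where "y b a = (\<lambda>M N. x (add_mset b M) (add_mset a N) / (of_nat (Suc k))\<^sup>2)" for b a
  define S where "S b a = (op_of ((raise ^^ Suc m) (y b a)) :: ('n, 'q) tensor_op)" for b a
  define R where "R b a = (op_of ((raise ^^ Suc m) (shift b a (y b a))) :: ('n, 'q) tensor_op)" for b a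
  define e :: "'q \<Rightarrow> 'q \<Rightarrow> complex ^ 'q ^ 'q" where "e b a = (\<chi> b' a'. if b' = b \<and> a' = a then 1 else 0)" for b a
  have S: "sym_act (e b a) ** S b a = op_of (shift b a ((raise ^^ Suc m) (y b a)))" for b a
  proof -
    have "(\<Sum>b'\<in>UNIV. \<Sum>a'\<in>UNIV. e b a $ b' $ a' * w b' a') = w b a" for w
    proof -
      have "(\<Sum>b'\<in>UNIV. \<Sum>a'\<in>UNIV. e b a $ b' $ a' * w b' a')
         = (\<Sum>b'\<in>UNIV. if b' = b then (\<Sum>a'\<in>UNIV. if a' = a then w b' a' else 0) else 0)"
        by (intro sum.cong refl) (simp add: e_def if_distrib[of "\<lambda>z. z * _"] cong: if_cong)
      then show ?thesis by simp
    qed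
    then show ?thesis
      unfolding S_def sym_act_mult_op_of by simp
  qed
  have "(\<Sum>b\<in>UNIV. \<Sum>a\<in>UNIV. ins b a (y b a) P Q) = x P Q" if "size P = Suc k" "size Q = Suc k" for P Q
  proof -
    have "ins b a (y b a) P Q = of_nat (count P b) * of_nat (count Q a) * (x P Q / (of_nat (Suc k))\<^sup>2)" for b a
      by (cases "b \<in># P \<and> a \<in># Q") (auto simp: ins_def y_def not_in_iff)
    then have "(\<Sum>b\<in>UNIV. \<Sum>a\<in>UNIV. ins b a (y b a) P Q)
       = of_nat (\<Sum>b\<in>UNIV. count P b) * of_nat (\<Sum>a\<in>UNIV. count Q a) * (x P Q / (of_nat (Suc k))\<^sup>2)"
      by (simp only: of_nat_sum sum_product) (simp only: sum_distrib_right)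
    then show ?thesis
      using that by (simp only: sum_count) (simp add: power2_eq_square del: of_nat_Suc)
  qed
  then have "(raise ^^ m) x M N = (raise ^^ m) (\<lambda>P Q. \<Sum>b\<in>UNIV. \<Sum>a\<in>UNIV. ins b a (y b a) P Q) M N"
    if "size M = CARD('n)" "size N = CARD('n)" for M N
    by (intro raise_pow_cong[where k = "Suc k"]) (use that assms in \<open>simp_all add: m_def\<close>)
  then have "(raise ^^ m) x M N = (\<Sum>b\<in>UNIV. \<Sum>a\<in>UNIV. (raise ^^ m) (ins b a (y b a)) M N)"
    if "size M = CARD('n)" "size N = CARD('n)" for M N
    unfolding raise_pow_sum using that by blast
  \<comment> \<open>\<open>shift_raise_pow\<close> solved for its commutator term.\<close>
  moreover have "(raise ^^ m) (ins b a (y b a)) M N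
     = (shift b a ((raise ^^ Suc m) (y b a)) M N + (- 1) * (raise ^^ Suc m) (shift b a (y b a)) M N) / of_nat (Suc m)" for M N b a
    unfolding shift_raise_pow by (simp del: of_nat_Suc)
  ultimately have "X = op_of (\<lambda>M N. \<Sum>b\<in>UNIV. \<Sum>a\<in>UNIV. (1 / of_nat (Suc m)) *
      (shift b a ((raise ^^ Suc m) (y b a)) M N + (- 1) * (raise ^^ Suc m) (shift b a (y b a)) M N))"
    unfolding X by (intro op_of_cong) (simp only: divide_inverse mult.commute mult_1_left mult_1_right)
  also have "\<dots> = (\<Sum>b\<in>UNIV. \<Sum>a\<in>UNIV. cscale (1 / of_nat (Suc m)) (sym_act (e b a) ** S b a + cscale (- 1) (id_Sym ** R b a)))"
    unfolding S unfolding R_def id_Sym_mult_op_of by (simp only: op_of_sum cscale_op_of op_of_add)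
  also have "\<dots> \<in> cmat.span ?G"
  proof -
    have "S b a \<in> filt k" "R b a \<in> filt k" for b a
      unfolding S_def R_def filt_def m by blast+
    moreover have "id_Sym \<in> (E_gen :: ('n, 'q) tensor_op set)"
      unfolding E_gen_def by (intro cmat.span_base) blast
    moreover have "sym_act (e b a) \<in> (E_gen :: ('n, 'q) tensor_op set)" for b a
      unfolding E_gen_eq by blast
    ultimately have "sym_act (e b a) ** S b a \<in> cmat.span ?G" "id_Sym ** R b a \<in> cmat.span ?G" for b a
      by (blast intro: cmat.span_base)+
    then show ?thesis
      by (intro cmat.span_sum cmat.span_scale cmat.span_add)
  qed
  finally show "X \<in> cmat.span ?G" .
qed

lemma span_E_products:
  "k \<le> CARD('n) \<Longrightarrow> cmat.span (E_products k) = (filt k :: ('n::finite, 'q::finite) tensor_op set)"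
proof (induction k)
  case 0
  then show ?case by (simp add: filt_0)
next
  case (Suc k)
  let ?P = "E_products k :: ('n, 'q) tensor_op set"
  have IH: "cmat.span ?P = filt k" and k: "k < CARD('n)"
    using Suc by auto
  have "A ** B \<in> cmat.span (E_products (Suc k))" if "A \<in> E_gen" "B \<in> cmat.span ?P" for A B
    using that(2)
  proof (induction rule: cmat.span_induct_alt)
    case base
    then show ?case using cmat.span_zero by simp
  next
    case (step c B' B)
    have "A ** B' \<in> E_products (Suc k)"
      using that step by auto
    then show ?case
      using step by (simp add: matrix_add_ldistrib mult_cscale_right cmat.span_add cmat.span_scale cmat.span_base del: E_products.simps)
  qed
  then have "{A ** B | A B. A \<in> E_gen \<and> B \<in> (filt k :: ('n, 'q) tensor_op set)} \<subseteq> cmat.span (E_products (Suc k))"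
    unfolding IH by blast
  then have "filt (Suc k) \<subseteq> cmat.span (E_products (Suc k) :: ('n, 'q) tensor_op set)"
    using filt_Suc_subset_span[OF k] cmat.span_mono cmat.span_span by blast
  moreover have "cmat.span (E_products (Suc k)) \<subseteq> (filt (Suc k) :: ('n, 'q) tensor_op set)"
    using E_gen_mult_filt[OF k] cmat.span_superset[of ?P] IH
    by (intro cmat.span_minimal subspace_filt) auto
  ultimately show ?case by blast
qed

lemma E_filt_eq: "k \<le> CARD('n) \<Longrightarrow> E_filt (real k) = (filt k :: ('n::finite, 'q::finite) tensor_op set)"
  by (cases "k = 0") (auto simp: E_filt_def filt_0 span_E_products)

lemma V_space_0: "V_space 0 = filt 0"
  by (simp add: V_space_def filt_0)

lemma V_space_Suc:
  "Suc t \<le> CARD('n) \<Longrightarrow>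
    V_space (Suc t) = {X \<in> filt (Suc t) :: ('n::finite, 'q::finite) tensor_op set. \<forall>Y\<in>filt t. hs_inner Y X = 0}"
  using E_filt_eq[of t, where 'n='n and 'q='q] E_filt_eq[of "Suc t", where 'n='n and 'q='q]
  by (simp add: V_space_def)

section \<open>Spectrum of the raising and lowering operators\<close>

text \<open>The D_m of the overview (\<open>twirl_op_of\<close>), with the ladders as the family U.
  In the constant, n!^2 comes from the pairing in \<open>sum_ladder\<close> and (n-m)!^2 from
  \<open>raise_pow\<close>.\<close>

definition twirl :: "nat \<Rightarrow> ('n::finite, 'q::finite) tensor_op \<Rightarrow> ('n, 'q) tensor_op" where
  "twirl m X = (\<Sum>P\<in>words (CARD('n) - m). \<Sum>Q\<in>words (CARD('n) - m).
     cscale (hs_inner (op_of (ladder m (mset P) (mset Q))) X / (fact (CARD('n) - m) * fact CARD('n))\<^sup>2)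
       (op_of (ladder m (mset P) (mset Q))))"

lemma cnj_ladder [simp]: "cnj (ladder m P Q M N) = ladder m P Q M N"
  by (simp add: ladder_def)

text \<open>Up to normalisation \<open>lower\<close> is the adjoint of \<open>raise\<close>, so
  pairing with \<open>raise\<close>^m of a matrix unit reads off one entry of \<open>lower\<close>^m
  x.\<close>

lemma sum_ladder:
  assumes "size P + m = n" "size Q + m = n"
  shows "(\<Sum>K\<in>words n. \<Sum>L\<in>words n. ladder m P Q (mset K) (mset L) * x (mset K) (mset L))
    = (fact n)\<^sup>2 * (lower ^^ m) x P Q"
proof -
  have "(\<Sum>K\<in>words n. \<Sum>L\<in>words n. ladder m P Q (mset K) (mset L) * x (mset K) (mset L))
    = (\<Sum>J\<in>words m. \<Sum>K\<in>words n. idker (P + mset J) (mset K) * (\<Sum>L\<in>words n. idker (Q + mset J) (mset L) * x (mset K) (mset L)))"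
    unfolding ladder_def sum_distrib_right sum_distrib_left
    by (simp add: idker_sym mult_ac sum.swap[of _ _ "words m"])
  also have "\<dots> = (\<Sum>J\<in>words m. (fact n)\<^sup>2 * x (P + mset J) (Q + mset J))"
  proof (intro sum.cong refl)
    fix J :: "'a list" assume "J \<in> words m"
    then have "size (P + mset J) = n" "size (Q + mset J) = n"
      using assms by (simp_all add: words_def)
    then show "(\<Sum>K\<in>words n. idker (P + mset J) (mset K) * (\<Sum>L\<in>words n. idker (Q + mset J) (mset L) * x (mset K) (mset L)))
      = (fact n)\<^sup>2 * x (P + mset J) (Q + mset J)"
      using sum_idker[of "Q + mset J" n "x K" for K] sum_idker[of "P + mset J" n "\<lambda>K. fact n * x K (Q + mset J)"]
      by (simp add: power2_eq_square)
  qed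
  finally show ?thesis
    by (simp add: lower_pow sum_distrib_left)
qed

lemma twirl_op_of:
  assumes "m \<le> CARD('n)"
  shows "twirl m (op_of x :: ('n::finite, 'q::finite) tensor_op) = op_of ((raise ^^ m) ((lower ^^ m) x))"
proof -
  define k where "k = CARD('n) - m"
  have k: "CARD('n) = k + m"
    using assms by (simp add: k_def)
  have hs: "hs_inner (op_of (ladder m (mset P) (mset Q)) :: ('n, 'q) tensor_op) (op_of x)
      = (fact CARD('n))\<^sup>2 * (lower ^^ m) x (mset P) (mset Q)" if "P \<in> words k" "Q \<in> words k" for P Q
    unfolding hs_inner_op_of cnj_ladder using that k by (intro sum_ladder) (simp_all add: words_def)
  have "twirl m (op_of x :: ('n, 'q) tensor_op) = (\<Sum>P\<in>words k. \<Sum>Q\<in>words k.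
     cscale ((lower ^^ m) x (mset P) (mset Q) / (fact k)\<^sup>2) (op_of (ladder m (mset P) (mset Q))))"
    unfolding twirl_def k_def[symmetric] by (intro sum.cong refl) (simp add: hs power_mult_distrib)
  also have "\<dots> = op_of ((raise ^^ m) ((lower ^^ m) x))"
    unfolding cscale_op_of op_of_sum by (intro op_of_cong) (simp add: raise_pow[where k = k] k)
  finally show ?thesis .
qed

lemma twirl_cscale: "twirl m (cscale c X) = cscale c (twirl m X)"
  by (simp add: twirl_def hs_inner_cscale_right vec_eq_iff sum_nth2 sum_distrib_left mult_ac)

lemma twirl_self_adjoint: "hs_inner (twirl m X) Y = hs_inner X (twirl m Y)"
  by (simp add: twirl_def hs_inner_sum_left hs_inner_sum_right hs_inner_cscale_left hs_inner_cscale_right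
      cnj_hs_inner mult_ac)

lemma twirl_0: "X \<in> L_Sym \<Longrightarrow> twirl 0 X = X"
  by (auto elim!: L_SymE simp: twirl_op_of)

text \<open>The scalar of \<open>lower_raise_pow\<close> at size s = n - 1, as it appears when
  \<open>raise\<close> brings the result back to size n. The eigenvalue of D_1 on V_t is its value
  at k = n - t.\<close>

definition gap :: "nat \<Rightarrow> nat \<Rightarrow> nat \<Rightarrow> complex" where
  "gap n q k = of_nat k * (2 * of_nat n + of_nat q - 1 - of_nat k)"

lemma raise_lower_raise_pow:
  fixes y :: "'q::finite kernel"
  assumes "size M = n" "size N = n"
  shows "raise (lower ((raise ^^ m) y)) M N = (raise ^^ Suc m) (lower y) M N + gap n CARD('q) m * (raise ^^ m) y M N"
proof (cases "n = 0")
  case True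
  with assms have "raise x M N = 0" for x
    by (simp add: raise_def)
  moreover have "gap n CARD('q) m * (raise ^^ m) y M N = 0"
    using assms True by (cases m) (simp_all add: gap_def raise_def)
  ultimately show ?thesis by simp
next
  case False
  then have n: "of_nat (n - 1) = (of_nat n - 1 :: complex)"
    by simp
  have "raise (lower ((raise ^^ m) y)) M N
      = raise (\<lambda>M N. (raise ^^ m) (lower y) M N + gap n CARD('q) m * (raise ^^ (m - 1)) y M N) M N"
  proof (rule raise_cong)
    fix M' N' :: "'q multiset" assume "Suc (size M') = size M" "Suc (size N') = size N"
    then have "size M' = n - 1" "size N' = n - 1"
      using assms by simp_all
    from lower_raise_pow[OF this, of m y]
    show "lower ((raise ^^ m) y) M' N' = (raise ^^ m) (lower y) M' N' + gap n CARD('q) m * (raise ^^ (m - 1)) y M' N'"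
      by (simp only: n gap_def) (simp add: algebra_simps)
  qed
  then show ?thesis
    by (cases m) (simp_all add: raise_add raise_scale gap_def)
qed

text \<open>Makes D_k the product of D_1 - gap_i over i < k, so that only the spectrum of D_1 has to
  be found.\<close>

lemma twirl_Suc:
  fixes X :: "('n::finite, 'q::finite) tensor_op"
  assumes "Suc k \<le> CARD('n)" "X \<in> L_Sym"
  shows "twirl (Suc k) X = twirl 1 (twirl k X) - cscale (gap CARD('n) CARD('q) k) (twirl k X)"
proof -
  obtain x where X: "X = op_of x"
    using assms by (blast elim: L_SymE)
  have *: "raise (lower ((raise ^^ k) y)) M N = (raise ^^ Suc k) (lower y) M N + gap CARD('n) CARD('q) k * (raise ^^ k) y M N"
    if "size M = CARD('n)" "size N = CARD('n)" for M N and y :: "'q kernel"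
    using that by (rule raise_lower_raise_pow)
  have "twirl 1 (twirl k X) = twirl (Suc k) X + cscale (gap CARD('n) CARD('q) k) (twirl k X)"
    using assms unfolding X by (simp add: twirl_op_of * cscale_op_of op_of_add cong: op_of_cong del: funpow.simps)
       (simp add: vec_eq_iff *)
  then show ?thesis by simp
qed

text \<open>The remainder is \<open>raise\<close>^(n-t+1) of \<open>lower y\<close>: one more factor
  z . w, hence one step down in the filtration. For t = 0 there are more factors than the size
  allows and it vanishes.\<close>

lemma twirl_filt:
  fixes X :: "('n::finite, 'q::finite) tensor_op"
  assumes "t \<le> CARD('n)" "X \<in> filt t"
  shows "twirl 1 X - cscale (gap CARD('n) CARD('q) (CARD('n) - t)) X \<in> (if t = 0 then {0} else filt (t - 1))"
proof -
  define m where "m = CARD('n) - t"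
  obtain y where X: "X = op_of ((raise ^^ m) y)"
    using assms by (auto simp: filt_def m_def)
  have 1: "twirl 1 X - cscale (gap CARD('n) CARD('q) m) X = op_of ((raise ^^ Suc m) (lower y))"
    unfolding X by (subst twirl_op_of) (simp_all add: vec_eq_iff raise_lower_raise_pow del: funpow.simps, simp add: raise_lower_raise_pow)
  show ?thesis
  proof (cases "t = 0")
    case True
    then show ?thesis
      unfolding m_def[symmetric] 1 by (simp add: vec_eq_iff raise_pow_eq_0 m_def del: funpow.simps)
  next
    case False
    then have "Suc m = CARD('n) - (t - 1)"
      using assms by (simp add: m_def)
    then show ?thesis
      unfolding m_def[symmetric] 1 filt_def using False by (auto simp del: funpow.simps)
  qed
qed

lemma twirl_one_mem_filt:
  fixes X :: "('n::finite, 'q::finite) tensor_op"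
  assumes "t \<le> CARD('n)" "X \<in> filt t"
  shows "twirl 1 X \<in> filt t"
proof -
  have "twirl 1 X - cscale (gap CARD('n) CARD('q) (CARD('n) - t)) X \<in> filt t"
    using twirl_filt[OF assms] filt_mono[of "t - 1" t, where 'n='n and 'q='q] assms(1) cmat.subspace_0[OF subspace_filt]
    by (auto split: if_splits)
  from cmat.subspace_add[OF subspace_filt this cmat.subspace_scale[OF subspace_filt assms(2),
        of "gap CARD('n) CARD('q) (CARD('n) - t)"]]
  show ?thesis by simp
qed

lemma V_space_subset_filt: "t \<le> CARD('n) \<Longrightarrow> V_space t \<subseteq> (filt t :: ('n::finite, 'q::finite) tensor_op set)"
  by (cases t) (auto simp: V_space_0 V_space_Suc)

text \<open>The residue lies in E_(t-1) by \<open>twirl_filt\<close>. It is also orthogonal to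
  E_(t-1), because D_1 is self-adjoint and preserves that space; hence it is zero.\<close>

lemma twirl_V_space:
  fixes X :: "('n::finite, 'q::finite) tensor_op"
  assumes "t \<le> CARD('n)" "X \<in> V_space t"
  shows "twirl 1 X = cscale (gap CARD('n) CARD('q) (CARD('n) - t)) X"
proof -
  let ?R = "twirl 1 X - cscale (gap CARD('n) CARD('q) (CARD('n) - t)) X"
  have X: "X \<in> filt t"
    using assms V_space_subset_filt by blast
  have "?R = 0"
  proof (cases t)
    case 0
    then show ?thesis
      using twirl_filt[OF assms(1) X] by simp
  next
    case (Suc s)
    then have R: "?R \<in> filt s"
      using twirl_filt[OF assms(1) X] by simp
    have "hs_inner Y ?R = 0" if "Y \<in> filt s" for Y
    proof -
      have "hs_inner (twirl 1 Y) X = 0" "hs_inner Y X = 0"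
        using assms Suc that twirl_one_mem_filt[of s Y] by (auto simp: V_space_Suc)
      then show ?thesis
        by (simp add: hs_inner_diff_right hs_inner_cscale_right flip: twirl_self_adjoint)
    qed
    from this[OF R] show ?thesis
      by (rule hs_inner_eq_0D)
  qed
  then show ?thesis by simp
qed

lemma twirl_eigen:
  fixes X :: "('n::finite, 'q::finite) tensor_op"
  assumes "X \<in> L_Sym" "twirl 1 X = cscale c X" "k \<le> CARD('n)"
  shows "twirl k X = cscale (\<Prod>i<k. c - gap CARD('n) CARD('q) i) X"
  using assms(3)
proof (induction k)
  case 0
  then show ?case by (simp add: twirl_0 assms)
next
  case (Suc k)
  let ?p = "\<Prod>i<k. c - gap CARD('n) CARD('q) i"
  have IH: "twirl k X = cscale ?p X"
    using Suc by simp
  have "twirl (Suc k) X = cscale ?p (cscale c X) - cscale (gap CARD('n) CARD('q) k) (cscale ?p X)"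
    unfolding twirl_Suc[OF Suc.prems assms(1)] IH twirl_cscale assms(2) ..
  then show ?case
    by (simp add: vec_eq_iff algebra_simps)
qed

text \<open>A product of two falling factorials of length k, from n - t and from n + t + q - 1. The
  first vanishes for k + t > n, which has to be said separately because truncated subtraction would
  put 0! there.\<close>

definition eigval :: "nat \<Rightarrow> nat \<Rightarrow> nat \<Rightarrow> nat \<Rightarrow> complex" where
  "eigval n q k t = (if k + t \<le> n then fact (n - t) * fact (n + t + q - 1) / (fact (n - t - k) * fact (n + t + q - 1 - k)) else 0)"

lemma prod_gap:
  assumes "t \<le> n" "q \<ge> 1"
  shows "(\<Prod>i<k. gap n q (n - t) - gap n q i) = eigval n q k t"
proof (induction k)
  case 0
  then show ?case using assms by (simp add: eigval_def)
next
  case (Suc k)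
  \<comment> \<open>\<open>gap\<close> is quadratic and takes equal values at k and 2n + q - 1 - k,
    so the difference splits into two linear factors.\<close>
  have g: "gap n q (n - t) - gap n q k = (of_nat (n - t) - of_nat k) * (of_nat (n + t + q - 1) - of_nat k)"
    using assms by (simp add: gap_def of_nat_diff algebra_simps)
  show ?case
  proof (cases "Suc k + t \<le> n")
    case True
    define a where "a = n - t - Suc k"
    define b where "b = n + t + q - 1 - Suc k"
    have ab: "n - t = Suc (a + k)" "n + t + q - 1 = Suc (b + k)"
      using True assms by (simp_all add: a_def b_def)
    have "eigval n q k t = fact (n - t) * fact (n + t + q - 1) / (fact (Suc a) * fact (Suc b))"
    proof -
      have "n - t - k = Suc a" "n + t + q - 1 - k = Suc b"
        using ab by simp_all
      with True show ?thesis by (simp only: eigval_def) simp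
    qed
    moreover have "gap n q (n - t) - gap n q k = of_nat (Suc a) * of_nat (Suc b)"
      unfolding g unfolding ab by simp
    ultimately have "eigval n q k t * (gap n q (n - t) - gap n q k) = fact (n - t) * fact (n + t + q - 1) / (fact a * fact b)"
      by (simp del: of_nat_Suc)
    then show ?thesis
      using True by (simp add: Suc.IH eigval_def a_def b_def)
  next
    case False
    show ?thesis
    proof (cases "k + t = n")
      case True
      then have "gap n q (n - t) - gap n q k = 0"
        unfolding g by auto
      with False Suc.IH show ?thesis by (simp add: eigval_def)
    next
      case False
      with \<open>\<not> Suc k + t \<le> n\<close> Suc.IH show ?thesis by (simp add: eigval_def)
    qed
  qed
qed

lemma twirl_V_space_eigval:
  fixes X :: "('n::finite, 'q::finite) tensor_op"
  assumes "t \<le> CARD('n)" "X \<in> V_space t" "k \<le> CARD('n)"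
  shows "twirl k X = cscale (eigval CARD('n) CARD('q) k t) X"
proof -
  have "X \<in> L_Sym"
    using assms V_space_subset_filt filt_subset_L_Sym by blast
  from twirl_eigen[OF this twirl_V_space[OF assms(1,2)] assms(3)] assms(1) show ?thesis
    by (simp add: prod_gap Suc_le_eq)
qed

text \<open>Replacing \<open>hs_inner E X\<close> times \<open>E\<close> by \<open>E ** X ** adj E\<close> turns \<open>twirl m\<close>
  into a multiple of \<open>twirl (n - m)\<close>.\<close>

lemma kraus_ladder:
  fixes X :: "('n::finite, 'q::finite) tensor_op"
  assumes "m + k = CARD('n)" "X \<in> L_Sym"
  shows "(\<Sum>P\<in>words k. \<Sum>Q\<in>words k. op_of (ladder m (mset P) (mset Q)) ** X ** adj (op_of (ladder m (mset P) (mset Q))))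
    = cscale ((fact m * fact CARD('n))\<^sup>2) (twirl k X)"
proof -
  obtain x where X: "X = op_of x"
    using assms by (blast elim: L_SymE)
  let ?n = "CARD('n)"
  \<comment> \<open>The entry (M, N) of U X U* for one ladder U. Each of the two ladders brings its
    own word, I and J, so x is read at Q extended by I and by J.\<close>
  have inner: "(\<Sum>L\<in>words ?n. (\<Sum>K\<in>words ?n. ladder m P Q M (mset K) * x (mset K) (mset L)) * ladder m P Q N (mset L))
     = (fact ?n)\<^sup>2 * (\<Sum>I\<in>words m. \<Sum>J\<in>words m. x (Q + mset I) (Q + mset J) * (idker M (P + mset I) * idker N (P + mset J)))"
    if "size Q = k" for M N P Q
  proof -
    have *: "(\<Sum>K\<in>words ?n. ladder m P Q M (mset K) * h (mset K)) = fact ?n * (\<Sum>I\<in>words m. idker M (P + mset I) * h (Q + mset I))" for M h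
    proof -
      have "(\<Sum>K\<in>words ?n. ladder m P Q M (mset K) * h (mset K))
         = (\<Sum>I\<in>words m. idker M (P + mset I) * (\<Sum>K\<in>words ?n. idker (Q + mset I) (mset K) * h (mset K)))"
        unfolding ladder_def sum_distrib_right sum_distrib_left
        by (simp add: idker_sym mult_ac sum.swap[of _ _ "words m"])
      also have "\<dots> = (\<Sum>I\<in>words m. idker M (P + mset I) * (fact ?n * h (Q + mset I)))"
        using that assms(1) by (intro sum.cong refl) (subst sum_idker, simp_all add: words_def)
      finally show ?thesis
        by (simp add: sum_distrib_left mult_ac)
    qed
    have "(\<Sum>L\<in>words ?n. (\<Sum>K\<in>words ?n. ladder m P Q M (mset K) * x (mset K) (mset L)) * ladder m P Q N (mset L))
      = (\<Sum>L\<in>words ?n. ladder m P Q N (mset L) * (fact ?n * (\<Sum>I\<in>words m. idker M (P + mset I) * x (Q + mset I) (mset L))))"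
      using *[of M "\<lambda>K. x K L" for L] by (simp add: mult_ac)
    also have "\<dots> = fact ?n * (\<Sum>J\<in>words m. idker N (P + mset J) * (fact ?n * (\<Sum>I\<in>words m. idker M (P + mset I) * x (Q + mset I) (Q + mset J))))"
      using *[of N "\<lambda>L. fact ?n * (\<Sum>I\<in>words m. idker M (P + mset I) * x (Q + mset I) L)"] by simp
    also have "\<dots> = (fact ?n)\<^sup>2 * (\<Sum>J\<in>words m. \<Sum>I\<in>words m. x (Q + mset I) (Q + mset J) * (idker M (P + mset I) * idker N (P + mset J)))"
      by (simp add: sum_distrib_left power2_eq_square mult_ac)
    also have "(\<Sum>J\<in>words m. \<Sum>I\<in>words m. x (Q + mset I) (Q + mset J) * (idker M (P + mset I) * idker N (P + mset J)))
      = (\<Sum>I\<in>words m. \<Sum>J\<in>words m. x (Q + mset I) (Q + mset J) * (idker M (P + mset I) * idker N (P + mset J)))"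
      by (rule sum.swap)
    finally show ?thesis .
  qed
  \<comment> \<open>Summing over Q turns x into \<open>lower\<close>^k x at (I, J), and summing over
    P builds \<open>ladder k\<close> at (I, J). The free letters now have length m and the summed
    ones length k.\<close>
  have outer: "(fact m)\<^sup>2 * (raise ^^ k) ((lower ^^ k) x) M N
    = (\<Sum>P\<in>words k. \<Sum>Q\<in>words k. \<Sum>I\<in>words m. \<Sum>J\<in>words m.
        x (mset Q + mset I) (mset Q + mset J) * (idker M (mset P + mset I) * idker N (mset P + mset J)))"
    if "size M = ?n" "size N = ?n" for M N
  proof -
    have "(fact m)\<^sup>2 * (raise ^^ k) ((lower ^^ k) x) M N = (\<Sum>I\<in>words m. \<Sum>J\<in>words m. \<Sum>Q\<in>words k. \<Sum>P\<in>words k.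
        x (mset Q + mset I) (mset Q + mset J) * (idker M (mset P + mset I) * idker N (mset P + mset J)))"
    proof -
      have c: "(fact m)\<^sup>2 * (z / (fact m)\<^sup>2 * w) = z * w" for z w :: complex
        by simp
      show ?thesis
        unfolding raise_pow[of M m k N, OF that[folded assms(1)]] sum_distrib_left c
        unfolding lower_pow ladder_def sum_product by (simp only: add.commute)
    qed
    also have "\<dots> = (\<Sum>Q\<in>words k. \<Sum>P\<in>words k. \<Sum>I\<in>words m. \<Sum>J\<in>words m.
        x (mset Q + mset I) (mset Q + mset J) * (idker M (mset P + mset I) * idker N (mset P + mset J)))"
      by (simp only: sum.swap[of _ "words m" "words k"])
    also have "\<dots> = (\<Sum>P\<in>words k. \<Sum>Q\<in>words k. \<Sum>I\<in>words m. \<Sum>J\<in>words m.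
        x (mset Q + mset I) (mset Q + mset J) * (idker M (mset P + mset I) * idker N (mset P + mset J)))"
      by (rule sum.swap)
    finally show ?thesis .
  qed
  have "(\<Sum>P\<in>words k. \<Sum>Q\<in>words k. op_of (ladder m (mset P) (mset Q)) ** X ** adj (op_of (ladder m (mset P) (mset Q))))
    = op_of (\<lambda>M N. \<Sum>P\<in>words k. \<Sum>Q\<in>words k. \<Sum>L\<in>words ?n. (\<Sum>K\<in>words ?n. ladder m (mset P) (mset Q) M (mset K) * x (mset K) (mset L))
        * ladder m (mset P) (mset Q) N (mset L))"
    unfolding X adj_op_of cnj_ladder op_of_mult op_of_sum ..
  also have "\<dots> = op_of (\<lambda>M N. (fact m * fact ?n)\<^sup>2 * (raise ^^ k) ((lower ^^ k) x) M N)"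
  proof (rule op_of_cong)
    fix M N :: "'q multiset" assume "size M = ?n" "size N = ?n"
    from outer[OF this, symmetric]
    show "(\<Sum>P\<in>words k. \<Sum>Q\<in>words k. \<Sum>L\<in>words ?n. (\<Sum>K\<in>words ?n. ladder m (mset P) (mset Q) M (mset K) * x (mset K) (mset L))
        * ladder m (mset P) (mset Q) N (mset L)) = (fact m * fact ?n)\<^sup>2 * (raise ^^ k) ((lower ^^ k) x) M N"
      by (simp add: inner size_mset_words power_mult_distrib flip: sum_distrib_left del: size_mset)
  qed
  also have "\<dots> = cscale ((fact m * fact ?n)\<^sup>2) (twirl k X)"
    using assms(1) unfolding X by (simp add: twirl_op_of cscale_op_of)
  finally show ?thesis .
qed

section \<open>Orthonormal bases and the exchange of tensor factors\<close>

lemma is_onb_mem: "is_onb B V \<Longrightarrow> E \<in> B \<Longrightarrow> E \<in> V"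
  by (auto simp: is_onb_def intro: cmat.span_base)

lemma Pi_map_add: "Pi_map B (X + Y) = Pi_map B X + Pi_map B Y"
  by (simp add: Pi_map_def hs_inner_add_right cmat.scale_left_distrib sum.distrib)

lemma Pi_map_diff: "Pi_map B (X - Y) = Pi_map B X - Pi_map B Y"
  by (simp add: Pi_map_def hs_inner_diff_right cmat.scale_left_diff_distrib sum_subtractf)

lemma Pi_map_cscale: "Pi_map B (cscale c X) = cscale c (Pi_map B X)"
  by (simp add: Pi_map_def hs_inner_cscale_right cmat.scale_sum_right)

lemma Pi_map_self_adjoint: "hs_inner (Pi_map B X) Y = hs_inner X (Pi_map B Y)"
  by (simp add: Pi_map_def hs_inner_sum_left hs_inner_sum_right hs_inner_cscale_left hs_inner_cscale_right
      cnj_hs_inner mult.commute)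

lemma Pi_map_mem: "is_onb B V \<Longrightarrow> Pi_map B X \<in> V"
  unfolding is_onb_def Pi_map_def by (metis (no_types, lifting) cmat.span_base cmat.span_scale cmat.span_sum)

lemma hs_inner_Pi_map:
  assumes "is_onb B V" "E \<in> B"
  shows "hs_inner E (Pi_map B X) = hs_inner E X"
proof -
  have "hs_inner E (Pi_map B X) = (\<Sum>F\<in>B. if E = F then hs_inner F X else 0)"
    unfolding Pi_map_def hs_inner_sum_right hs_inner_cscale_right
    using assms by (intro sum.cong) (auto simp: is_onb_def)
  then show ?thesis
    using assms by (simp add: is_onb_def)
qed

lemma Pi_map_id:
  assumes "is_onb B V" "X \<in> V"
  shows "Pi_map B X = X"
proof -
  have "X \<in> cmat.span B"
    using assms by (simp add: is_onb_def)
  then show ?thesis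
  proof (induction rule: cmat.span_induct_alt)
    case base
    then show ?case by (simp add: Pi_map_def)
  next
    case (step c E Y)
    have "Pi_map B E = (\<Sum>F\<in>B. if F = E then F else 0)"
      unfolding Pi_map_def using step(1) assms(1) by (intro sum.cong) (auto simp: is_onb_def)
    also have "\<dots> = E"
      using step(1) assms(1) by (simp add: is_onb_def)
    finally show ?case
      using step by (simp add: Pi_map_add Pi_map_cscale)
  qed
qed

text \<open>One Gram-Schmidt step: the residue of a is normalised, or a is dropped if the residue is
  zero.\<close>

lemma is_onb_span_insert:
  assumes B: "is_onb B (cmat.span S)"
  shows "\<exists>B'. is_onb B' (cmat.span (insert a S))"
proof -
  define r where "r = a - Pi_map B a"
  have a: "a = r + Pi_map B a"
    by (simp add: r_def)
  have Pi: "Pi_map B a \<in> cmat.span S"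
    using B by (rule Pi_map_mem)
  show ?thesis
  proof (cases "r = 0")
    case True
    then have "a \<in> cmat.span S"
      using a Pi by simp
    then have "cmat.span (insert a S) = cmat.span S"
      by (rule cmat.span_redundant)
    with B show ?thesis by metis
  next
    case False
    define d where "d = (\<Sum>i\<in>UNIV. \<Sum>j\<in>UNIV. (cmod (r $ i $ j))\<^sup>2)"
    have rr: "hs_inner r r = of_real d"
      by (simp only: d_def hs_inner_self)
    moreover have "d \<ge> 0"
      by (simp add: d_def sum_nonneg)
    ultimately have "d > 0"
      using False hs_inner_eq_0D[of r] by (cases "d = 0") auto
    define e where "e = cscale (of_real (1 / sqrt d)) r"
    have "hs_inner e e = of_real ((1 / sqrt d) * ((1 / sqrt d) * d))"
      by (simp only: e_def hs_inner_cscale_left hs_inner_cscale_right rr complex_cnj_complex_of_real of_real_mult)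
    also have "(1 / sqrt d) * ((1 / sqrt d) * d) = 1"
      using \<open>d > 0\<close> by (simp add: field_simps)
    finally have ee: "hs_inner e e = 1" by simp
    have Ee: "hs_inner E e = 0" if "E \<in> B" for E
      using hs_inner_Pi_map[OF B that] by (simp add: e_def r_def hs_inner_cscale_right hs_inner_diff_right)
    then have eE: "hs_inner e E = 0" if "E \<in> B" for E
      using that by (metis cnj_hs_inner complex_cnj_zero)
    have re: "r = cscale (of_real (sqrt d)) e"
      using \<open>d > 0\<close> by (simp add: e_def flip: of_real_mult del: real_sqrt_mult_self)
    have sub: "cmat.span S \<subseteq> cmat.span (insert e B)" "cmat.span B \<subseteq> cmat.span (insert a S)"
      using B unfolding is_onb_def by (metis cmat.span_mono subset_insertI)+
    have "r \<in> cmat.span (insert a S)"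
      unfolding r_def using Pi cmat.span_mono[OF subset_insertI, of S a] cmat.span_base[of a "insert a S"]
      by (intro cmat.span_diff) auto
    then have "e \<in> cmat.span (insert a S)"
      unfolding e_def by (rule cmat.span_scale)
    moreover have "a \<in> cmat.span (insert e B)"
    proof -
      have "r \<in> cmat.span (insert e B)"
        unfolding re by (intro cmat.span_scale cmat.span_base) simp
      then have "r + Pi_map B a \<in> cmat.span (insert e B)"
        using Pi sub(1) by (intro cmat.span_add) auto
      then show ?thesis
        using a by metis
    qed
    ultimately have "cmat.span (insert e B) = cmat.span (insert a S)"
      using sub cmat.span_superset[of S] cmat.span_superset[of B]
      by (intro equalityI cmat.span_minimal cmat.subspace_span) auto
    moreover have "e \<notin> B"
      using Ee[of e] ee by auto
    ultimately have "is_onb (insert e B) (cmat.span (insert a S))"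
      using B ee Ee eE by (auto simp: is_onb_def)
    then show ?thesis by blast
  qed
qed

text \<open>Complex independence implies real independence, and the matrices form a Euclidean space
  over the reals.\<close>

lemma cmat_independent_imp_finite:
  fixes S :: "(complex ^ 'm::finite ^ 'm) set"
  assumes "cmat.independent S"
  shows "finite S"
proof -
  have "\<not> dependent S"
  proof
    assume "dependent S"
    then obtain T u where T: "finite T" "T \<subseteq> S" "(\<Sum>v\<in>T. u v *\<^sub>R v) = 0" and v: "\<exists>v\<in>T. u v \<noteq> 0"
      unfolding dependent_explicit by blast
    have "(\<Sum>v\<in>T. cscale (of_real (u v)) v) = (\<Sum>v\<in>T. u v *\<^sub>R v)"
      by (simp add: vec_eq_iff sum_nth2) (simp add: scaleR_conv_of_real)
    moreover have "\<exists>v\<in>T. complex_of_real (u v) \<noteq> 0"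
      using v by simp
    ultimately have "cmat.dependent S"
      unfolding cmat.dependent_explicit using T by (intro exI[of _ T] exI[of _ "\<lambda>v. of_real (u v)"]) simp
    with assms show False by simp
  qed
  then show ?thesis
    by (rule independent_imp_finite)
qed

lemma ex_onb:
  fixes V :: "(complex ^ 'm::finite ^ 'm) set"
  assumes "cmat.subspace V"
  shows "\<exists>B. is_onb B V"
proof -
  obtain S where S: "S \<subseteq> V" "cmat.independent S" "V \<subseteq> cmat.span S"
    by (rule cmat.maximal_independent_subset)
  have "finite S"
    using S(2) by (rule cmat_independent_imp_finite)
  then have "\<exists>B. is_onb B (cmat.span S)"
  proof (induction S)
    case empty
    show ?case by (rule exI[of _ "{}"]) (simp add: is_onb_def)
  next
    case (insert a S)
    then show ?case using is_onb_span_insert by blast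
  qed
  moreover have "cmat.span S = V"
    using S assms by (intro equalityI cmat.span_minimal)
  ultimately show ?thesis by simp
qed

section \<open>Orthogonal decomposition of the operators on Sym into the V_t\<close>

lemma subspace_V_space:
  "t \<le> CARD('n) \<Longrightarrow> cmat.subspace (V_space t :: ('n::finite, 'q::finite) tensor_op set)"
proof (cases t)
  case (Suc s)
  assume "t \<le> CARD('n)"
  moreover have "cmat.subspace {X \<in> filt t :: ('n, 'q) tensor_op set. \<forall>Y\<in>filt s. hs_inner Y X = 0}"
    using subspace_filt[of t]
    by (auto simp: cmat.subspace_def hs_inner_add_right hs_inner_cscale_right)
  ultimately show ?thesis
    using Suc by (simp add: V_space_Suc)
qed (simp add: V_space_0 subspace_filt)

lemma twirl_add: "twirl m (X + Y) = twirl m X + twirl m Y"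
  by (simp add: twirl_def hs_inner_add_right add_divide_distrib cmat.scale_left_distrib sum.distrib)

lemma twirl_zero: "twirl m 0 = 0"
  by (simp add: twirl_def)

lemma twirl_sum: "twirl m (\<Sum>a\<in>S. X a) = (\<Sum>a\<in>S. twirl m (X a))"
  by (induction S rule: infinite_finite_induct) (simp_all add: twirl_add twirl_zero)

locale onb_family =
  fixes B :: "nat \<Rightarrow> ('n::finite, 'q::finite) tensor_op set"
  assumes onb: "t \<le> CARD('n) \<Longrightarrow> is_onb (B t) (V_space t)"
begin

lemma B_subset_L_Sym: "t \<le> CARD('n) \<Longrightarrow> E \<in> B t \<Longrightarrow> E \<in> L_Sym"
  using onb is_onb_mem V_space_subset_filt filt_subset_L_Sym by blast

lemma Pi_map_eq_0_filt:
  assumes "t \<le> CARD('n)" "s < t" "X \<in> filt s"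
  shows "Pi_map (B t) X = 0"
proof -
  obtain t' where t: "t = Suc t'"
    using assms(2) by (cases t) auto
  have X: "X \<in> filt t'"
    using assms filt_mono[of s t', where 'n='n and 'q='q] t by auto
  have "hs_inner E X = 0" if "E \<in> B t" for E
  proof -
    have "E \<in> V_space t"
      using is_onb_mem[OF onb[OF assms(1)] that] .
    then have "hs_inner X E = 0"
      using X assms(1) unfolding t by (simp add: V_space_Suc)
    then show ?thesis
      by (metis cnj_hs_inner complex_cnj_zero)
  qed
  then show ?thesis
    by (simp add: Pi_map_def)
qed

lemma Pi_map_mem_filt: "t \<le> k \<Longrightarrow> k \<le> CARD('n) \<Longrightarrow> Pi_map (B t) X \<in> filt k"
  by (meson Pi_map_mem V_space_subset_filt filt_mono le_trans onb subsetD)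

text \<open>By induction the projections up to k reproduce E_k; being self-adjoint, they leave a
  residue orthogonal to E_k, which therefore lies in V_(k+1).\<close>

lemma filt_decomp: "k \<le> CARD('n) \<Longrightarrow> X \<in> filt k \<Longrightarrow> (\<Sum>t\<le>k. Pi_map (B t) X) = X"
proof (induction k arbitrary: X)
  case 0
  then show ?case
    using Pi_map_id[OF onb, of 0 X] by (simp add: V_space_0)
next
  case (Suc k)
  define S where "S = (\<Sum>t\<le>k. Pi_map (B t) X)"
  have S: "S \<in> filt k"
    unfolding S_def using Suc.prems by (intro cmat.subspace_sum subspace_filt Pi_map_mem_filt) auto
  have "hs_inner Z (X - S) = 0" if Z: "Z \<in> filt k" for Z
  proof -
    have "hs_inner Z S = hs_inner (\<Sum>t\<le>k. Pi_map (B t) Z) X"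
      by (simp add: S_def hs_inner_sum_left hs_inner_sum_right Pi_map_self_adjoint)
    also have "(\<Sum>t\<le>k. Pi_map (B t) Z) = Z"
      using Suc Z by simp
    finally show ?thesis
      by (simp add: hs_inner_diff_right)
  qed
  moreover have "X - S \<in> filt (Suc k)"
    using S Suc.prems filt_Suc[of k, where 'n='n and 'q='q] by (intro cmat.subspace_diff subspace_filt) auto
  ultimately have "X - S \<in> V_space (Suc k)"
    using Suc.prems by (simp add: V_space_Suc)
  then have "X - S = Pi_map (B (Suc k)) (X - S)"
    using Pi_map_id[OF onb, of "Suc k" "X - S"] Suc.prems by simp
  also have "\<dots> = Pi_map (B (Suc k)) X"
    using Pi_map_eq_0_filt[of "Suc k" k S] S Suc.prems by (simp add: Pi_map_diff)
  finally show ?case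
    by (simp add: S_def algebra_simps)
qed

lemma L_Sym_decomp: "X \<in> L_Sym \<Longrightarrow> (\<Sum>t\<le>CARD('n). Pi_map (B t) X) = X"
  by (rule filt_decomp) (simp_all add: filt_top)

lemma twirl_decomp:
  assumes "m \<le> CARD('n)" "X \<in> L_Sym"
  shows "twirl m X = (\<Sum>t\<le>CARD('n). cscale (eigval CARD('n) CARD('q) m t) (Pi_map (B t) X))"
proof -
  have "twirl m X = twirl m (\<Sum>t\<le>CARD('n). Pi_map (B t) X)"
    using assms by (simp add: L_Sym_decomp)
  also have "\<dots> = (\<Sum>t\<le>CARD('n). cscale (eigval CARD('n) CARD('q) m t) (Pi_map (B t) X))"
    unfolding twirl_sum using assms(1) by (intro sum.cong refl twirl_V_space_eigval Pi_map_mem onb) auto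
  finally show ?thesis .
qed

end

text \<open>Both expressions are contractions of the sum of c U \<otimes> conj U. Testing the
  hypothesis on symmetrised matrix units recovers all entries of this tensor, because every U and E
  lies in \<open>L_Sym\<close>.\<close>

lemma kraus_exchange:
  fixes U :: "'a \<Rightarrow> ('n::finite, 'q::finite) tensor_op" and E :: "'b \<Rightarrow> ('n, 'q) tensor_op"
  assumes U: "\<And>a. a \<in> I \<Longrightarrow> U a \<in> L_Sym" and E: "\<And>b. b \<in> J \<Longrightarrow> E b \<in> L_Sym"
    and eq: "\<And>X. X \<in> L_Sym \<Longrightarrow>
      (\<Sum>a\<in>I. cscale (c a * hs_inner (U a) X) (U a)) = (\<Sum>b\<in>J. cscale (d b * hs_inner (E b) X) (E b))"
  shows "(\<Sum>a\<in>I. cscale (c a) (U a ** X ** adj (U a))) = (\<Sum>b\<in>J. cscale (d b) (E b ** X ** adj (E b)))"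
proof -
  have tensor: "(\<Sum>a\<in>I. c a * U a $ f $ g * cnj (U a $ f' $ g')) = (\<Sum>b\<in>J. d b * E b $ f $ g * cnj (E b $ f' $ g'))"
    for f g f' g'
  proof -
    \<comment> \<open>A symmetrised matrix unit: pairing with it reads off one entry of Y,
      conjugated, times n!^2.\<close>
    let ?X = "op_of (\<lambda>M N. idker M (slots f') * idker N (slots g')) :: ('n, 'q) tensor_op"
    have hs: "hs_inner Y ?X = (fact CARD('n))\<^sup>2 * cnj (Y $ f' $ g')" if Y: "Y \<in> L_Sym" for Y
    proof -
      obtain y where y: "Y = op_of y"
        using Y by (blast elim: L_SymE)
      have "hs_inner Y ?X = (\<Sum>K\<in>words CARD('n). idker (slots f') (mset K) *
          (\<Sum>L\<in>words CARD('n). idker (slots g') (mset L) * cnj (y (mset K) (mset L))))"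
        unfolding y hs_inner_op_of by (simp add: sum_distrib_left mult_ac idker_sym)
      also have "\<dots> = (fact CARD('n))\<^sup>2 * cnj (y (slots f') (slots g'))"
        using sum_idker[of "slots g'" "CARD('n)" "\<lambda>L. cnj (y K L)" for K]
          sum_idker[of "slots f'" "CARD('n)" "\<lambda>K. fact CARD('n) * cnj (y K (slots g'))"]
        by (simp add: power2_eq_square)
      finally show ?thesis
        by (simp add: y)
    qed
    have "(\<Sum>a\<in>I. c a * hs_inner (U a) ?X * U a $ f $ g) = (\<Sum>b\<in>J. d b * hs_inner (E b) ?X * E b $ f $ g)"
      using arg_cong[OF eq[OF op_of_in_L_Sym], of "\<lambda>Z. Z $ f $ g"] by (simp add: sum_nth2)
    then have "(fact CARD('n))\<^sup>2 * (\<Sum>a\<in>I. c a * U a $ f $ g * cnj (U a $ f' $ g'))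
       = (fact CARD('n))\<^sup>2 * (\<Sum>b\<in>J. d b * E b $ f $ g * cnj (E b $ f' $ g'))"
      by (simp add: hs U E sum_distrib_left mult_ac cong: sum.cong)
    then show ?thesis by simp
  qed
  have entry: "(\<Sum>a\<in>S. cscale (w a) (F a ** X ** adj (F a))) $ f $ h
     = (\<Sum>g'\<in>UNIV. \<Sum>g\<in>UNIV. X $ g $ g' * (\<Sum>a\<in>S. w a * F a $ f $ g * cnj (F a $ h $ g')))"
    for S :: "'c set" and w and F :: "'c \<Rightarrow> ('n, 'q) tensor_op" and f h
  proof -
    have "(\<Sum>a\<in>S. cscale (w a) (F a ** X ** adj (F a))) $ f $ h
      = (\<Sum>a\<in>S. \<Sum>g'\<in>UNIV. \<Sum>g\<in>UNIV. X $ g $ g' * (w a * F a $ f $ g * cnj (F a $ h $ g')))"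
      by (simp add: sum_nth2 matrix_matrix_mult_def sum_distrib_left sum_distrib_right mult_ac)
    also have "\<dots> = (\<Sum>g'\<in>UNIV. \<Sum>a\<in>S. \<Sum>g\<in>UNIV. X $ g $ g' * (w a * F a $ f $ g * cnj (F a $ h $ g')))"
      by (rule sum.swap)
    also have "\<dots> = (\<Sum>g'\<in>UNIV. \<Sum>g\<in>UNIV. \<Sum>a\<in>S. X $ g $ g' * (w a * F a $ f $ g * cnj (F a $ h $ g')))"
      by (rule sum.cong[OF refl], rule sum.swap)
    finally show ?thesis
      by (simp only: sum_distrib_left)
  qed
  show ?thesis
    unfolding vec_eq_iff entry tensor by blast
qed

text \<open>The ladders and the bases, weighted by eigenvalues, both represent D_(n-k). Exchange
  turns the bases into a sum of the Phi_t and the ladders into a multiple of D_k.\<close>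

lemma (in onb_family) Phi_map_relation:
  assumes "k \<le> CARD('n)" "X \<in> L_Sym"
  shows "(\<Sum>t\<le>CARD('n). cscale (eigval CARD('n) CARD('q) (CARD('n) - k) t) (Phi_map (B t) X))
    = cscale ((fact (CARD('n) - k) / fact k)\<^sup>2) (twirl k X)"
proof -
  define m where "m = CARD('n) - k"
  have m: "m \<le> CARD('n)" "m + k = CARD('n)" "CARD('n) - m = k"
    using assms(1) by (simp_all add: m_def)
  define U where "U = (\<lambda>(P, Q). op_of (ladder m (mset P) (mset Q)) :: ('n, 'q) tensor_op)"
  \<comment> \<open>The coefficient in \<open>twirl m\<close>, where n - m = k.\<close>
  define r :: complex where "r = 1 / (fact k * fact CARD('n))\<^sup>2"
  let ?I = "words k \<times> words k" and ?J = "SIGMA t:{..CARD('n)}. B t"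
  have fin: "\<forall>t\<in>{..CARD('n)}. finite (B t)"
    using onb by (auto simp: is_onb_def)
  have "(\<Sum>a\<in>?I. cscale r (U a ** X ** adj (U a)))
    = (\<Sum>b\<in>?J. cscale (eigval CARD('n) CARD('q) m (fst b)) (snd b ** X ** adj (snd b)))"
  proof (rule kraus_exchange)
    show "U a \<in> L_Sym" if "a \<in> ?I" for a
      by (simp add: U_def case_prod_unfold op_of_in_L_Sym)
    show "snd b \<in> L_Sym" if "b \<in> ?J" for b
      using that B_subset_L_Sym by auto
    fix Y :: "('n, 'q) tensor_op" assume Y: "Y \<in> L_Sym"
    have "(\<Sum>a\<in>?I. cscale (r * hs_inner (U a) Y) (U a)) = twirl m Y"
      by (simp add: twirl_def m(3) U_def r_def sum.cartesian_product case_prod_unfold)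
    also have "\<dots> = (\<Sum>t\<le>CARD('n). \<Sum>E\<in>B t. cscale (eigval CARD('n) CARD('q) m t * hs_inner E Y) E)"
      unfolding twirl_decomp[OF m(1) Y] Pi_map_def by (simp add: cmat.scale_sum_right)
    also have "\<dots> = (\<Sum>b\<in>?J. cscale (eigval CARD('n) CARD('q) m (fst b) * hs_inner (snd b) Y) (snd b))"
      using fin by (subst sum.Sigma) (simp_all add: case_prod_unfold)
    finally show "(\<Sum>a\<in>?I. cscale (r * hs_inner (U a) Y) (U a))
       = (\<Sum>b\<in>?J. cscale (eigval CARD('n) CARD('q) m (fst b) * hs_inner (snd b) Y) (snd b))" .
  qed
  moreover have "(\<Sum>b\<in>?J. cscale (eigval CARD('n) CARD('q) m (fst b)) (snd b ** X ** adj (snd b)))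
     = (\<Sum>t\<le>CARD('n). cscale (eigval CARD('n) CARD('q) m t) (Phi_map (B t) X))"
    using fin unfolding Phi_map_def cmat.scale_sum_right by (subst sum.Sigma) (simp_all add: case_prod_unfold)
  moreover have "(\<Sum>a\<in>?I. cscale r (U a ** X ** adj (U a)))
      = cscale r (\<Sum>P\<in>words k. \<Sum>Q\<in>words k. op_of (ladder m (mset P) (mset Q)) ** X ** adj (op_of (ladder m (mset P) (mset Q))))"
    by (simp add: U_def sum.cartesian_product case_prod_unfold cmat.scale_sum_right)
  moreover have "\<dots> = cscale ((fact m / fact k)\<^sup>2) (twirl k X)"
    unfolding kraus_ladder[OF m(2) assms(2)] by (simp add: r_def power_mult_distrib power_divide)
  ultimately show ?thesis
    unfolding m_def by simp
qed

section \<open>Inverting the triangular system\<close>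

text \<open>The closed form that makes the alternating sum telescope. Over the full range i \<le> d
  the sum is, up to sign and d!, the d-th difference of (A + i + d - 1)! / (A + i)!, a polynomial in
  i of degree d - 1, and so it vanishes. Here p < d keeps d - Suc p from being truncated.\<close>

lemma alternating_partial_sum:
  fixes A d :: nat
  assumes "A \<ge> 1" "p < d"
  shows "(\<Sum>i\<le>p. (- 1) ^ i * fact (A + i + d - 1) / (fact i * fact (d - i) * fact (A + i)) :: complex)
    = (- 1) ^ p * fact (A + p + d) / (fact p * fact (d - Suc p) * fact (A + p) * of_nat d * of_nat (A + d))"
  using assms(2)
proof (induction p)
  case 0
  obtain d' where d: "d = Suc d'" using 0 by (cases d) auto
  show ?case
    using assms(1) by (simp add: d divide_simps del: of_nat_Suc of_nat_add)
next
  case (Suc p)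
  define c where "c = d - Suc (Suc p)"
  have d: "d = Suc (Suc (c + p))" using Suc.prems by (simp add: c_def)
  have eqs: "A + Suc p + d - 1 = A + p + d" "d - Suc p = Suc c" "d - Suc (Suc p) = c" "A + Suc p + d = Suc (A + p + d)"
    "A + Suc p = Suc (A + p)"
    by (simp_all add: d)
  have IH: "(\<Sum>i\<le>p. (- 1) ^ i * fact (A + i + d - 1) / (fact i * fact (d - i) * fact (A + i)) :: complex)
    = (- 1) ^ p * fact (A + p + d) / (fact p * fact (Suc c) * fact (A + p) * of_nat d * of_nat (A + d))"
    using Suc by (simp add: eqs(2))
  define F G H K :: complex where "F = fact (A + p + d)" and "G = fact p" and "H = fact c" and "K = fact (A + p)"
  define a x y :: complex where "a = of_nat A" and "x = of_nat p" and "y = of_nat c"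
  have nz: "G \<noteq> 0" "H \<noteq> 0" "K \<noteq> 0" "F \<noteq> 0"
    by (simp_all add: F_def G_def H_def K_def)
  have f: "fact (Suc c) = (y + 1) * H" "fact (Suc p) = (x + 1) * G" "fact (Suc (A + p)) = (a + x + 1) * K"
      "fact (Suc (A + p + d)) = (a + 2 * x + y + 3) * F" "complex_of_nat d = x + y + 2" "complex_of_nat (A + d) = a + x + y + 2"
    by (simp_all add: F_def G_def H_def K_def a_def x_def y_def d algebra_simps)
  have "y + 1 = of_nat (Suc c)" "x + 1 = of_nat (Suc p)" "a + x + 1 = of_nat (Suc (A + p))"
    "x + y + 2 = of_nat (Suc (Suc (c + p)))" "a + x + y + 2 = of_nat (Suc (Suc (A + p + c)))"
    by (simp_all add: a_def x_def y_def)
  then have nz2: "y + 1 \<noteq> 0" "x + 1 \<noteq> 0" "a + x + 1 \<noteq> 0" "x + y + 2 \<noteq> 0" "a + x + y + 2 \<noteq> 0"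
    by (simp_all only: of_nat_eq_0_iff)
  \<comment> \<open>In the variables u, v, w below, the numerator is u v - (u + w)(v + w) = - w (u +
    v + w), and w cancels.\<close>
  have frac: "1 / ((y + 1) * (x + y + 2) * (a + x + y + 2)) - 1 / ((x + 1) * (y + 1) * (a + x + 1))
      = - (a + 2 * x + y + 3) / ((x + 1) * (a + x + 1) * (x + y + 2) * (a + x + y + 2))"
  proof -
    define u v w where "u = x + 1" and "v = a + x + 1" and "w = y + 1"
    have e: "x + y + 2 = u + w" "a + x + y + 2 = v + w" "a + 2 * x + y + 3 = u + v + w"
      by (simp_all add: u_def v_def w_def)
    have "u \<noteq> 0" "v \<noteq> 0" "w \<noteq> 0" "u + w \<noteq> 0" "v + w \<noteq> 0"
      using nz2 unfolding e by (simp_all add: u_def v_def w_def)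
    then have "1 / (w * (u + w) * (v + w)) - 1 / (u * w * v) = - (u + v + w) / (u * v * (u + w) * (v + w))"
      by (simp add: divide_simps) (simp add: algebra_simps)
    then show ?thesis
      unfolding e by (simp add: u_def v_def w_def)
  qed
  have key: "s * F / (G * ((y + 1) * H) * K * (x + y + 2) * (a + x + y + 2)) + - s * F / ((x + 1) * G * ((y + 1) * H) * ((a + x + 1) * K))
      = - s * ((a + 2 * x + y + 3) * F) / ((x + 1) * G * H * ((a + x + 1) * K) * (x + y + 2) * (a + x + y + 2))" for s
  proof -
    have "s * F / (G * ((y + 1) * H) * K * (x + y + 2) * (a + x + y + 2)) + - s * F / ((x + 1) * G * ((y + 1) * H) * ((a + x + 1) * K))
      = s * F / (G * H * K) * (1 / ((y + 1) * (x + y + 2) * (a + x + y + 2)) - 1 / ((x + 1) * (y + 1) * (a + x + 1)))"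
      by (simp add: right_diff_distrib mult_ac)
    also have "\<dots> = - s * ((a + 2 * x + y + 3) * F) / ((x + 1) * G * H * ((a + x + 1) * K) * (x + y + 2) * (a + x + y + 2))"
      unfolding frac by (simp add: mult_ac del: minus_add_distrib)
    finally show ?thesis .
  qed
  have "(\<Sum>i\<le>Suc p. (- 1) ^ i * fact (A + i + d - 1) / (fact i * fact (d - i) * fact (A + i)) :: complex)
    = (- 1) ^ p * fact (A + p + d) / (fact p * fact (Suc c) * fact (A + p) * of_nat d * of_nat (A + d))
     + - ((- 1) ^ p) * fact (A + p + d) / (fact (Suc p) * fact (Suc c) * fact (Suc (A + p)))"
    unfolding sum.atMost_Suc IH eqs by simp
  also have "\<dots> = - ((- 1) ^ p) * fact (Suc (A + p + d)) / (fact (Suc p) * fact c * fact (Suc (A + p)) * of_nat d * of_nat (A + d))"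
    unfolding f F_def[symmetric] G_def[symmetric] H_def[symmetric] K_def[symmetric] by (rule key)
  finally show ?case
    unfolding eqs by simp
qed

text \<open>The last term i = d cancels the closed form of the partial sum up to d - 1.\<close>

lemma alternating_sum_eq_0:
  fixes A d :: nat
  assumes "A \<ge> 1" "d > 0"
  shows "(\<Sum>i\<le>d. (- 1) ^ i * fact (A + i + d - 1) / (fact i * fact (d - i) * fact (A + i)) :: complex) = 0"
proof -
  obtain p where d: "d = Suc p" using assms(2) by (cases d) auto
  have "(\<Sum>i\<le>p. (- 1) ^ i * fact (A + i + d - 1) / (fact i * fact (d - i) * fact (A + i)) :: complex)
    = (- 1) ^ p * fact (A + p + d) / (fact p * fact (d - Suc p) * fact (A + p) * of_nat d * of_nat (A + d))"
    using assms by (intro alternating_partial_sum) (simp_all add: d)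
  moreover have "fact (A + d) = (of_nat (A + d) * fact (A + p) :: complex)" "fact d = (of_nat d * fact p :: complex)"
    by (simp_all only: d add_Suc_right fact_Suc)
  ultimately show ?thesis
    by (simp add: d del: of_nat_Suc of_nat_add fact_Suc)
qed

text \<open>Inverts the triangular matrix 1 / ((k - t)! (k + t + q - 1)!), the classical limit of
  Bailey's inversion. With A = 2t + q - 1, d = T - t and i = k - t it becomes the vanishing
  alternating sum.\<close>

lemma inversion_orthogonality:
  assumes "q \<ge> 2" "t \<le> T"
  shows "(\<Sum>k\<in>{t..T}. (- 1) ^ (T - k) * fact (T + k + q - 2) / (fact (T - k) * (fact (k - t) * fact (k + t + q - 1))) :: complex)
    = (if t = T then 1 / of_nat (2 * T + q - 1) else 0)"
proof (cases "t = T")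
  case True
  define w where "w = 2 * T + q - 2"
  have "T + T + q - 2 = w" "T + T + q - 1 = Suc w" "2 * T + q - 1 = Suc w"
    using assms(1) by (simp_all add: w_def)
  with True show ?thesis
    by (simp del: of_nat_Suc)
next
  case False
  define d where "d = T - t"
  define A where "A = 2 * t + q - 1"
  have d: "d > 0" "T = t + d" "A \<ge> 1"
    using False assms by (simp_all add: d_def A_def)
  have "(\<Sum>k\<in>{t..T}. (- 1) ^ (T - k) * fact (T + k + q - 2) / (fact (T - k) * (fact (k - t) * fact (k + t + q - 1))) :: complex)
     = (\<Sum>i\<le>d. (- 1) ^ (d - i) * fact (A + i + d - 1) / (fact (d - i) * (fact i * fact (A + i))))"
  proof (rule sum.reindex_bij_witness[where i = "\<lambda>i. t + i" and j = "\<lambda>k. k - t"])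
    fix k assume k: "k \<in> {t..T}"
    then have e: "d - (k - t) = T - k" "A + (k - t) + d - 1 = T + k + q - 2" "A + (k - t) = k + t + q - 1"
      using assms(1) by (auto simp: d_def A_def)
    show "(- 1) ^ (d - (k - t)) * fact (A + (k - t) + d - 1) / (fact (d - (k - t)) * (fact (k - t) * fact (A + (k - t))))
      = ((- 1) ^ (T - k) * fact (T + k + q - 2) / (fact (T - k) * (fact (k - t) * fact (k + t + q - 1))) :: complex)"
      unfolding e(1,2) unfolding e(3) ..
  qed (use assms(2) in \<open>auto simp: d_def\<close>)
  also have "\<dots> = (- 1) ^ d * (\<Sum>i\<le>d. (- 1) ^ i * fact (A + i + d - 1) / (fact i * fact (d - i) * fact (A + i)))"
    unfolding sum_distrib_left
  proof (rule sum.cong[OF refl])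
    fix i assume "i \<in> {..d}"
    then have "(- 1) ^ d = ((- 1) ^ (d - i) * (- 1) ^ i :: complex)"
      by (simp flip: power_add)
    then have "(- 1) ^ (d - i) = ((- 1) ^ d * (- 1) ^ i :: complex)"
      by (simp add: mult.assoc minus_one_mult_self)
    then show "(- 1) ^ (d - i) * fact (A + i + d - 1) / (fact (d - i) * (fact i * fact (A + i)))
       = ((- 1) ^ d * ((- 1) ^ i * fact (A + i + d - 1) / (fact i * fact (d - i) * fact (A + i))) :: complex)"
      by (simp only: times_divide_eq_right mult_ac)
  qed
  also have "\<dots> = 0"
    unfolding alternating_sum_eq_0[OF d(3,1)] by simp
  finally show ?thesis
    using False by simp
qed

lemma eigval_inversion:
  assumes q: "q \<ge> 2" and T: "T \<le> n"
    and eq: "\<And>k. k \<le> n \<Longrightarrow> (\<Sum>t\<le>n. eigval n q (n - k) t * \<phi> t) = b k"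
  shows "\<phi> T = of_nat (2 * T + q - 1) / (fact (n - T) * fact (n + T + q - 1)) *
     (\<Sum>k\<le>T. (- 1) ^ (T - k) * fact (T + k + q - 2) / fact (T - k) * b k)"
proof -
  \<comment> \<open>For the index n - k, the denominator of the eigenvalue is (k - t)! (k + t + q -
    1)!, free of n; its numerator depends on t alone and is absorbed into u.\<close>
  define u where "u t = fact (n - t) * fact (n + t + q - 1) * \<phi> t" for t
  have b: "b k = (\<Sum>t\<le>k. u t / (fact (k - t) * fact (k + t + q - 1)))" if "k \<le> n" for k
  proof -
    have "b k = (\<Sum>t\<le>k. eigval n q (n - k) t * \<phi> t)"
      unfolding eq[OF that, symmetric]
      by (rule sum.mono_neutral_right) (use that in \<open>auto simp: eigval_def\<close>)
    also have "\<dots> = (\<Sum>t\<le>k. u t / (fact (k - t) * fact (k + t + q - 1)))"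
    proof (rule sum.cong[OF refl])
      fix t assume "t \<in> {..k}"
      then have "n - t - (n - k) = k - t" "n + t + q - 1 - (n - k) = k + t + q - 1" "n - k + t \<le> n"
        using that q by auto
      then show "eigval n q (n - k) t * \<phi> t = u t / (fact (k - t) * fact (k + t + q - 1))"
        by (simp only: eigval_def u_def) simp
    qed
    finally show ?thesis .
  qed
  have "(\<Sum>k\<le>T. (- 1) ^ (T - k) * fact (T + k + q - 2) / fact (T - k) * b k)
     = (\<Sum>k\<le>T. \<Sum>t\<le>k. u t * ((- 1) ^ (T - k) * fact (T + k + q - 2) / (fact (T - k) * (fact (k - t) * fact (k + t + q - 1)))))"
  proof (rule sum.cong[OF refl])
    fix k assume "k \<in> {..T}"
    then have k: "k \<le> n"
      using T by simp
    have c: "z / g * (v / y) = v * (z / (g * y))" for z g v y :: complex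
      by simp
    show "(- 1) ^ (T - k) * fact (T + k + q - 2) / fact (T - k) * b k
      = (\<Sum>t\<le>k. u t * ((- 1) ^ (T - k) * fact (T + k + q - 2) / (fact (T - k) * (fact (k - t) * fact (k + t + q - 1)))))"
      unfolding b[OF k] sum_distrib_left c ..
  qed
  also have "\<dots> = (\<Sum>t\<le>T. \<Sum>k\<in>{t..T}. u t * ((- 1) ^ (T - k) * fact (T + k + q - 2) / (fact (T - k) * (fact (k - t) * fact (k + t + q - 1)))))"
    by (simp add: sum.Sigma, rule sum.reindex_bij_witness[of _ "\<lambda>(t, k). (k, t)" "\<lambda>(k, t). (t, k)"]) auto
  also have "\<dots> = (\<Sum>t\<le>T. if t = T then u T / of_nat (2 * T + q - 1) else 0)"
  proof (rule sum.cong[OF refl])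
    fix t assume "t \<in> {..T}"
    then show "(\<Sum>k\<in>{t..T}. u t * ((- 1) ^ (T - k) * fact (T + k + q - 2) / (fact (T - k) * (fact (k - t) * fact (k + t + q - 1)))))
        = (if t = T then u T / of_nat (2 * T + q - 1) else 0)"
      unfolding sum_distrib_left[symmetric] by (subst inversion_orthogonality[OF q]) simp_all
  qed
  also have "\<dots> = u T / of_nat (2 * T + q - 1)"
    by simp
  finally show ?thesis
    using q by (simp add: u_def del: of_nat_add of_nat_mult)
qed

section \<open>The coefficients\<close>

definition crossing_coeff :: "nat \<Rightarrow> nat \<Rightarrow> nat \<Rightarrow> nat \<Rightarrow> real" where
  "crossing_coeff n q t j = real (2 * t + q - 1) * fact (n - j) * fact (n + j + q - 1) /
         (fact (n - t) * fact (n + t + q - 1)) *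
       (\<Sum>s = nat (max 0 (int t + int j - int n))..t.
          (- 1) ^ s * fact (2 * t + q - 2 - s) * (fact (s + n - t))\<^sup>2 /
          (fact s * fact (nat (int s - (int t + int j - int n))) *
           fact (s + n - t + j + q - 1) * (fact (t - s))\<^sup>2))"

text \<open>The substitution s = t - k. The eigenvalue vanishes unless k + j \<le> n, that is s
  \<ge> t + j - n, which gives the lower limit. The factor z will be a matrix entry of X.\<close>

lemma crossing_coeff_eq:
  assumes "q \<ge> 2" "t \<le> n" "j \<le> n"
  shows "of_nat (2 * t + q - 1) / (fact (n - t) * fact (n + t + q - 1)) *
     (\<Sum>k\<le>t. (- 1) ^ (t - k) * fact (t + k + q - 2) / fact (t - k) *
        ((fact (n - k) / fact k)\<^sup>2 * (eigval n q k j * z)))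
     = of_real (crossing_coeff n q t j) * z"
proof -
  define lo where "lo = nat (max 0 (int t + int j - int n))"
  define F where "F k = (- 1) ^ (t - k) * fact (t + k + q - 2) / fact (t - k) *
        ((fact (n - k) / fact k)\<^sup>2 * (eigval n q k j * z))" for k
  define G where "G s = ((- 1) ^ s * fact (2 * t + q - 2 - s) * (fact (s + n - t))\<^sup>2 /
          (fact s * fact (nat (int s - (int t + int j - int n))) *
           fact (s + n - t + j + q - 1) * (fact (t - s))\<^sup>2) :: real)" for s
  have "(\<Sum>k\<le>t. F k) = (\<Sum>s\<le>t. F (t - s))"
    by (rule sum.reindex_bij_witness[of _ "\<lambda>s. t - s" "\<lambda>k. t - k"]) auto
  also have "\<dots> = (\<Sum>s\<in>{lo..t}. F (t - s))"
    by (rule sum.mono_neutral_right) (auto simp: lo_def F_def eigval_def)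
  also have "\<dots> = (\<Sum>s\<in>{lo..t}. fact (n - j) * fact (n + j + q - 1) * (of_real (G s) * z))"
  proof (rule sum.cong[OF refl])
    fix s assume "s \<in> {lo..t}"
    then have s: "s \<le> t" "t + j \<le> n + s"
      by (auto simp: lo_def)
    define r where "r = n - j - (t - s)"
    have e: "t - (t - s) = s" "t + (t - s) + q - 2 = 2 * t + q - 2 - s" "n - (t - s) = s + n - t"
      "n + j + q - 1 - (t - s) = s + n - t + j + q - 1"
      "nat (int s - (int t + int j - int n)) = r" "n - j - (t - s) = r" "t - s + j \<le> n"
      using s assms by (auto simp: r_def)
    have ev: "eigval n q (t - s) j = fact (n - j) * fact (n + j + q - 1) / (fact r * fact (s + n - t + j + q - 1))"
      using e(7) by (simp only: eigval_def e(4,6)) simp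
    show "F (t - s) = fact (n - j) * fact (n + j + q - 1) * (of_real (G s) * z)"
      unfolding F_def G_def ev e(1-3,5) by (simp add: power_divide mult_ac)
  qed
  also have "\<dots> = fact (n - j) * fact (n + j + q - 1) * (of_real (\<Sum>s\<in>{lo..t}. G s) * z)"
    by (simp add: sum_distrib_left sum_distrib_right)
  finally have "(\<Sum>k\<le>t. F k) = fact (n - j) * fact (n + j + q - 1) * (of_real (\<Sum>s\<in>{lo..t}. G s) * z)" .
  then show ?thesis
    unfolding crossing_coeff_def F_def[symmetric] G_def[symmetric] lo_def[symmetric]
    by (simp del: of_real_sum of_nat_add of_nat_mult)
qed

text \<open>On V_j, D_k is a scalar, so each matrix entry of the Phi_t(X) satisfies the triangular
  system with right-hand side a multiple of the same entry of X.\<close>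

lemma (in onb_family) Phi_map_V_space:
  assumes "CARD('q) \<ge> 2" "t \<le> CARD('n)" "j \<le> CARD('n)" "X \<in> V_space j"
  shows "Phi_map (B t) X = cscale (of_real (crossing_coeff CARD('n) CARD('q) t j)) X"
proof -
  let ?n = "CARD('n)" and ?q = "CARD('q)"
  have X: "X \<in> L_Sym"
    using assms V_space_subset_filt filt_subset_L_Sym by blast
  have "Phi_map (B t) X $ f $ g = of_real (crossing_coeff ?n ?q t j) * X $ f $ g" for f g
  proof -
    have "(\<Sum>s\<le>?n. eigval ?n ?q (?n - k) s * Phi_map (B s) X $ f $ g)
        = (fact (?n - k) / fact k)\<^sup>2 * (eigval ?n ?q k j * X $ f $ g)" if "k \<le> ?n" for k
      using arg_cong[OF Phi_map_relation[OF that X], of "\<lambda>Z. Z $ f $ g"]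
      by (simp add: sum_nth2 twirl_V_space_eigval[OF assms(3,4) that])
    from eigval_inversion[OF assms(1,2) this] show ?thesis
      unfolding crossing_coeff_eq[OF assms(1-3)] .
  qed
  then show ?thesis
    by (simp add: vec_eq_iff)
qed

section \<open>Nonvanishing of the spaces V_j, needed for uniqueness of the coefficients\<close>

lemma raise_pow_ladder: "(raise ^^ m) (ladder 0 P Q) = ladder m P Q"
proof (induction m)
  case (Suc m)
  have "raise (ladder m P Q) = ladder (Suc m) P Q"
    by (simp add: fun_eq_iff raise_ladder)
  with Suc show ?case by simp
qed simp

lemma gap_neq:
  assumes "t < j" "j \<le> n" "q \<ge> 1"
  shows "gap n q (n - t) \<noteq> gap n q (n - j)"
proof -
  have "gap n q (n - t) - gap n q (n - j) = of_nat (j - t) * of_nat (t + j + q - 1)"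
    using assms by (simp add: gap_def of_nat_diff algebra_simps)
  moreover have "\<dots> \<noteq> (0 :: complex)"
    unfolding mult_eq_0_iff of_nat_eq_0_iff using assms by simp
  ultimately have "gap n q (n - t) - gap n q (n - j) \<noteq> 0"
    by metis
  then show ?thesis by auto
qed

lemma ex_onb_family: "\<exists>B :: nat \<Rightarrow> ('n::finite, 'q::finite) tensor_op set. onb_family B"
proof -
  have "\<exists>B. t \<le> CARD('n) \<longrightarrow> is_onb B (V_space t :: ('n, 'q) tensor_op set)" for t
    using ex_onb[OF subspace_V_space] by blast
  then show ?thesis
    unfolding onb_family_def by metis
qed

text \<open>The witness has symbol (z . w)^(n-j) z_a^j w_b^j with a \<noteq> b. The monomial is
  killed by \<open>lower\<close>, so the witness is an eigenvector of D_1 whose eigenvalue differs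
  from those on V_t for t < j. It is therefore orthogonal to these spaces, while lying in
  E_j.\<close>

lemma V_space_nonzero:
  assumes "CARD('q) \<ge> 2" "j \<le> CARD('n)"
  shows "\<exists>X \<in> (V_space j :: ('n::finite, 'q::finite) tensor_op set). X \<noteq> 0"
proof -
  have "\<not> (\<forall>a b :: 'q. a = b)"
    using assms(1) card_le_Suc0_iff_eq[of "UNIV :: 'q set"] by auto
  then obtain a b :: 'q where ab: "a \<noteq> b" by blast
  define m where "m = CARD('n) - j"
  define P Q where "P = replicate_mset j a" and "Q = replicate_mset j b"
  define X where "X = (op_of (ladder m P Q) :: ('n, 'q) tensor_op)"
  have X_raise: "X = op_of ((raise ^^ m) (ladder 0 P Q))"
    by (simp add: X_def raise_pow_ladder)
  then have X: "X \<in> filt j"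
    unfolding filt_def m_def by blast
  have nz: "X \<noteq> 0"
  proof
    assume "X = 0"
    \<comment> \<open>At this entry the only contributing word consists of m copies of a, so nothing
      can cancel.\<close>
    define M N where "M = P + replicate_mset m a" and "N = Q + replicate_mset m a"
    have "size M = CARD('n)" "size N = CARD('n)"
      using assms(2) by (simp_all add: M_def N_def P_def Q_def m_def)
    then obtain f g :: "'n \<Rightarrow> 'q" where "slots f = M" "slots g = N"
      using ex_slots by blast
    with \<open>X = 0\<close> have "ladder m P Q M N = 0"
      by (metis X_def op_of_nth zero_index)
    moreover have "ladder m P Q M N = (\<Sum>J\<in>words m. if J = replicate m a then idker M M * idker N N else 0)"
      unfolding ladder_def
    proof (rule sum.cong[OF refl])
      fix J :: "'q list"
      have "mset J = replicate_mset m a \<longleftrightarrow> J = replicate m a"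
      proof
        assume *: "mset J = replicate_mset m a"
        show "J = replicate m a"
        proof (rule replicate_eqI)
          show "length J = m"
            using arg_cong[OF *, of size] by simp
          show "y = a" if "y \<in> set J" for y
            using that arg_cong[OF *, of set_mset] by (auto split: if_splits)
        qed
      qed (simp)
      then show "idker M (P + mset J) * idker N (Q + mset J) = (if J = replicate m a then idker M M * idker N N else 0)"
        by (auto simp: M_def N_def idker_def)
    qed
    moreover have "\<dots> = idker M M * idker N N"
      by (subst sum.delta[OF finite_words]) (simp add: words_def)
    ultimately show False
      by (simp add: idker_def)
  qed
  have "lower (ladder 0 P Q) M N = 0" for M N
  proof -
    have "idker (add_mset i M) P * idker (add_mset i N) Q = 0" for i
    proof -
      have "i = a" if "add_mset i M = P"
        using that[symmetric] by (metis P_def in_replicate_mset union_single_eq_member)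
      moreover have "i = b" if "add_mset i N = Q"
        using that[symmetric] by (metis Q_def in_replicate_mset union_single_eq_member)
      ultimately show ?thesis
        using ab by (auto simp: idker_def)
    qed
    then show ?thesis
      unfolding lower_def by (intro sum.neutral) (simp add: ladder_def)
  qed
  then have low: "lower (ladder 0 P Q) = (\<lambda>M N. 0 * 0)"
    by (simp add: fun_eq_iff)
  have "raise (lower ((raise ^^ m) (ladder 0 P Q))) M N = gap CARD('n) CARD('q) m * (raise ^^ m) (ladder 0 P Q) M N"
    if "size M = CARD('n)" "size N = CARD('n)" for M N
    unfolding raise_lower_raise_pow[OF that] low raise_pow_scale by simp
  moreover have "twirl 1 X = op_of (raise (lower ((raise ^^ m) (ladder 0 P Q))))"
    unfolding X_raise by (subst twirl_op_of) (simp_all add: Suc_le_eq)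
  ultimately have "twirl 1 X = cscale (gap CARD('n) CARD('q) m) X"
    unfolding X_raise cscale_op_of by (auto intro: op_of_cong)
  then have tw: "twirl 1 X = cscale (gap CARD('n) CARD('q) (CARD('n) - j)) X"
    by (simp add: m_def)
  obtain B where "onb_family (B :: nat \<Rightarrow> ('n, 'q) tensor_op set)"
    using ex_onb_family by blast
  then interpret onb_family B .
  have "Pi_map (B t) X = 0" if t: "t < j" for t
  proof -
    have "hs_inner E X = 0" if E: "E \<in> B t" for E
    proof -
      have "E \<in> V_space t"
        using is_onb_mem[OF onb E] t assms(2) by simp
      then have "twirl 1 E = cscale (gap CARD('n) CARD('q) (CARD('n) - t)) E"
        using t assms(2) by (intro twirl_V_space) simp_all
      with twirl_self_adjoint[of 1 E X] tw
      have "gap CARD('n) CARD('q) (CARD('n) - t) * hs_inner E X = gap CARD('n) CARD('q) (CARD('n) - j) * hs_inner E X"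
        \<comment> \<open>The second simplification removes the conjugate from \<open>gap\<close>,
          which is real.\<close>
        by (simp add: hs_inner_cscale_left hs_inner_cscale_right) (simp add: gap_def)
      then show ?thesis
        using gap_neq[OF t assms(2), of "CARD('q)"] assms(1) by simp
    qed
    then show ?thesis
      by (simp add: Pi_map_def)
  qed
  moreover have "(\<Sum>t\<le>j. Pi_map (B t) X) = (\<Sum>t<j. Pi_map (B t) X) + Pi_map (B j) X"
    by (simp add: lessThan_Suc_atMost[symmetric])
  ultimately have "Pi_map (B j) X = X"
    using filt_decomp[OF assms(2) X] by simp
  then have "X \<in> V_space j"
    using Pi_map_mem[OF onb[OF assms(2)]] by metis
  with nz show ?thesis by blast
qed

section \<open>Linearity of Phi_t and the projections restricted to V_j\<close>

lemma Phi_map_add: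
  fixes X Y :: "complex ^ 'a::finite ^ 'a"
  shows "Phi_map B (X + Y) = Phi_map B X + Phi_map B Y"
proof -
  have "(P + Q) ** R = P ** R + Q ** R" for P Q R :: "complex ^ 'a ^ 'a"
    by (simp add: vec_eq_iff matrix_matrix_mult_def distrib_right sum.distrib)
  then show ?thesis
    by (simp add: Phi_map_def matrix_add_ldistrib sum.distrib)
qed

lemma Phi_map_cscale: "Phi_map B (cscale c X) = cscale c (Phi_map B X)"
  by (simp add: Phi_map_def mult_cscale_left mult_cscale_right cmat.scale_sum_right)

lemma Phi_map_sum: "Phi_map B (\<Sum>a\<in>S. X a) = (\<Sum>a\<in>S. Phi_map B (X a))"
proof -
  have "Phi_map B 0 = 0"
    by (simp add: Phi_map_def)
  then show ?thesis
    by (induction S rule: infinite_finite_induct) (simp_all add: Phi_map_add)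
qed

lemma scaleR_eq_cscale: "r *\<^sub>R X = cscale (of_real r) X"
  by (simp add: vec_eq_iff) (simp add: scaleR_conv_of_real)

lemma (in onb_family) Pi_map_V_space:
  assumes "i \<le> CARD('n)" "j \<le> CARD('n)" "X \<in> V_space j"
  shows "Pi_map (B i) X = (if i = j then X else 0)"
proof (cases i j rule: linorder_cases)
  case less
  have "hs_inner E X = 0" if "E \<in> B i" for E
  proof -
    have "E \<in> V_space i" "i \<le> j - 1" "j - 1 \<le> CARD('n)"
      using is_onb_mem[OF onb that] less assms by simp_all
    then have "E \<in> filt (j - 1)"
      using V_space_subset_filt[OF assms(1), where 'q='q] filt_mono[of i "j - 1", where 'n='n and 'q='q] by blast
    then show ?thesis
      using assms less by (cases j) (auto simp: V_space_Suc)
  qed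
  then show ?thesis
    using less by (simp add: Pi_map_def)
next
  case equal
  then show ?thesis
    using Pi_map_id[OF onb assms(3)] assms by simp
next
  case greater
  then show ?thesis
    using Pi_map_eq_0_filt[OF assms(1) greater] V_space_subset_filt[OF assms(2)] assms(3) by auto
qed

theorem proposition3p6p6:
  fixes q n :: nat and W :: "nat \<Rightarrow> nat \<Rightarrow> real"
  assumes "q = CARD('q::finite)" and "n = CARD('n::finite)" and "q \<ge> 2" and "n \<ge> 1"
  shows "W_coeffs TYPE('n) TYPE('q) W \<longleftrightarrow>
    (\<forall>t\<le>n. \<forall>j\<le>n. W t j =
       real (2 * t + q - 1) * fact (n - j) * fact (n + j + q - 1) /
         (fact (n - t) * fact (n + t + q - 1)) *
       (\<Sum>s = nat (max 0 (int t + int j - int n))..t.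
          (- 1) ^ s * fact (2 * t + q - 2 - s) * (fact (s + n - t))\<^sup>2 /
          (fact s * fact (nat (int s - (int t + int j - int n))) *
           fact (s + n - t + j + q - 1) * (fact (t - s))\<^sup>2)))"
  unfolding crossing_coeff_def[symmetric]
proof
  assume formula: "\<forall>t\<le>n. \<forall>j\<le>n. W t j = crossing_coeff n q t j"
  show "W_coeffs TYPE('n) TYPE('q) W"
    unfolding W_coeffs_def
  proof (intro allI impI ballI)
    fix B :: "nat \<Rightarrow> ('n, 'q) tensor_op set" and t and X :: "('n, 'q) tensor_op"
    assume "\<forall>t\<le>CARD('n). is_onb (B t) (V_space t)" and t: "t \<le> CARD('n)" and X: "X \<in> L_Sym"
    then interpret onb_family B
      by unfold_locales blast
    have "Phi_map (B t) X = (\<Sum>j\<le>CARD('n). Phi_map (B t) (Pi_map (B j) X))"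
      unfolding Phi_map_sum[symmetric] L_Sym_decomp[OF X] ..
    also have "\<dots> = (\<Sum>j\<le>CARD('n). W t j *\<^sub>R Pi_map (B j) X)"
    proof (rule sum.cong[OF refl])
      fix j assume "j \<in> {..CARD('n)}"
      then have j: "j \<le> CARD('n)" by simp
      show "Phi_map (B t) (Pi_map (B j) X) = W t j *\<^sub>R Pi_map (B j) X"
        using Phi_map_V_space[OF _ t j Pi_map_mem[OF onb[OF j]], of X] formula assms t j
        by (simp add: scaleR_eq_cscale)
    qed
    finally show "Phi_map (B t) X = (\<Sum>j\<le>CARD('n). W t j *\<^sub>R Pi_map (B j) X)" .
  qed
next
  assume W: "W_coeffs TYPE('n) TYPE('q) W"
  \<comment> \<open>\<open>W_coeffs\<close> quantifies over all families of orthonormal bases, so it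
    says something about W only once one such family is known to exist.\<close>
  obtain B where "onb_family (B :: nat \<Rightarrow> ('n, 'q) tensor_op set)"
    using ex_onb_family by blast
  then interpret onb_family B .
  show "\<forall>t\<le>n. \<forall>j\<le>n. W t j = crossing_coeff n q t j"
  proof (intro allI impI)
    fix t j assume "t \<le> n" "j \<le> n"
    then have t: "t \<le> CARD('n)" and j: "j \<le> CARD('n)"
      using assms(2) by simp_all
    \<comment> \<open>The hypothesis covers self-adjoint operators only, and the nonzero X in V_j
      need not be one. \<open>R\<close> is complex linear, so the identity extends to X through its
      Hermitian parts \<open>Y\<close> and \<open>Z\<close>.\<close>
    define R where "R Y = (\<Sum>i\<le>CARD('n). cscale (of_real (W t i)) (Pi_map (B i) Y))" for Y
    have R_lin: "R (Y + cscale c Z) = R Y + cscale c (R Z)" for Y Z c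
      by (simp add: R_def Pi_map_add Pi_map_cscale cmat.scale_right_distrib sum.distrib cmat.scale_sum_right mult.commute)
    have sa: "Phi_map (B t) Y = R Y" if "Y \<in> L_Sym" "adj Y = Y" for Y
      using W onb t that unfolding W_coeffs_def R_def by (simp add: scaleR_eq_cscale)
    obtain X :: "('n, 'q) tensor_op" where X: "X \<in> V_space j" "X \<noteq> 0"
      using V_space_nonzero[OF _ j] assms by blast
    then have "X \<in> L_Sym"
      using V_space_subset_filt[OF j] filt_subset_L_Sym by blast
    then obtain x where x: "X = op_of x"
      by (blast elim: L_SymE)
    define Y where "Y = cscale (1/2) (X + adj X)"
    define Z where "Z = cscale (- \<i>/2) (X - adj X)"
    have "Y = op_of (\<lambda>M N. 1/2 * (x M N + cnj (x N M)))" "Z = op_of (\<lambda>M N. - \<i>/2 * (x M N - cnj (x N M)))"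
      by (simp_all add: Y_def Z_def x vec_eq_iff)
    then have YZ: "Y \<in> L_Sym" "Z \<in> L_Sym"
      by (simp_all add: op_of_in_L_Sym)
    have adj: "adj Y = Y" "adj Z = Z"
      by (simp_all add: Y_def Z_def vec_eq_iff algebra_simps)
    have XYZ: "X = Y + cscale \<i> Z"
      by (simp add: Y_def Z_def vec_eq_iff flip: mult.assoc) (simp add: field_simps)
    have "Phi_map (B t) X = R X"
      unfolding XYZ R_lin Phi_map_add Phi_map_cscale sa[OF YZ(1) adj(1)] sa[OF YZ(2) adj(2)] ..
    also have "R X = (\<Sum>i\<le>CARD('n). if i = j then cscale (of_real (W t j)) X else 0)"
      unfolding R_def using j X(1) by (intro sum.cong refl) (simp add: Pi_map_V_space)
    also have "\<dots> = cscale (of_real (W t j)) X"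
      using j by simp
    finally have "cscale (of_real (crossing_coeff n q t j)) X = cscale (of_real (W t j)) X"
      using Phi_map_V_space[OF _ t j X(1)] assms by simp
    then show "W t j = crossing_coeff n q t j"
      using X(2) by simp
  qed
qed

end
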